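(* Let $\theta\in\mathbb{R}\setminus\mathbb{Q}$, let $A_\theta$ be the irrational rotation C*-algebra generated by unitaries $U,V$ with $UV=e^{2\pi i\theta}VU$, with its unique normalized faithful trace $\tau$ (given on $A_\theta^\infty$ by $\tau(\sum a_{m,n}U^mV^n)=a_{0,0}$). Let $s\in\mathbb{Z}\setminus\{0\}$ and let $a=\sum_{n\in\mathbb{Z}} a_nU^nV^{sn}\in A_\theta^\infty$ with $a>0$. Then $$\tau(a^2\log a)\leq \sum_{n\in\mathbb{Z}}(1+|s|)\,|n|\,|a_n|^2+\|a\|_2^2\log\|a\|_2 ,$$ where $\|a\|_2^2=\tau(a^*a)=\sum_{n\in\mathbb{Z}}|a_n|^2$.
   Context: $A_\theta^\infty=\{\sum_{(m,n)\in\mathbb{Z}^2}a_{m,n}U^mV^n : \sup_{(m,n)}(1+m^2+n^2)^k|a_{m,n}|^2<\infty \text{ for all } k\in\mathbb{N}\}$ is the smooth noncommutative two torus, a dense *-subalgebra of $A_\theta$. The notation $a>0$ means $a$ is self-adjoint with spectrum contained in $(0,\infty)$ (strictly positive), so that $\log a$ is defined by continuous functional calculus. *)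

theory Defs
  imports "HOL-Analysis.Analysis" "HOL-Computational_Algebra.Polynomial" "HOL-Library.Complex_Order"
begin

text \<open>Concrete model of the irrational rotation algebra A_theta via its GNS
representation for the trace tau: an element x is identified with its vector
of Fourier coefficients (x_{m,n}) (coefficient of U^m V^n), a square-summable
function on Z^2; the algebra acts on l^2(Z^2) by twisted convolution
(left regular representation), which is faithful and gives the C*-norm.
Convention: U V = lambda V U with lambda = exp(2 pi i theta).\<close>

type_synonym coeffs = "int \<times> int \<Rightarrow> complex"

definition rot :: "real \<Rightarrow> int \<Rightarrow> complex" where
  "rot \<theta> k = cis (2 * pi * \<theta> * of_int k)"

text \<open>(U^p V^q)(U^m' V^n') = lambda^(-q m') U^(p+m') V^(q+n').\<close>
definition tw_mult :: "real \<Rightarrow> coeffs \<Rightarrow> coeffs \<Rightarrow> coeffs" where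
  "tw_mult \<theta> f g = (\<lambda>(m,n). \<Sum>\<^sub>\<infinity>(p,q)\<in>UNIV.
      f (p,q) * g (m - p, n - q) * rot \<theta> (- (q * (m - p))))"

text \<open>(U^m V^n)^* = lambda^(-mn) U^(-m) V^(-n).\<close>
definition tw_star :: "real \<Rightarrow> coeffs \<Rightarrow> coeffs" where
  "tw_star \<theta> f = (\<lambda>(p,q). cnj (f (-p,-q)) * rot \<theta> (- (p * q)))"

definition one_c :: coeffs where
  "one_c = (\<lambda>x. if x = (0,0) then 1 else 0)"

definition tau :: "coeffs \<Rightarrow> complex" where
  "tau f = f (0,0)"

definition l2norm :: "coeffs \<Rightarrow> real" where
  "l2norm f = sqrt (\<Sum>\<^sub>\<infinity>x\<in>UNIV. (cmod (f x))^2)"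

definition op_norm_set :: "real \<Rightarrow> coeffs \<Rightarrow> real set" where
  "op_norm_set \<theta> f = {l2norm (tw_mult \<theta> f g) | g.
       finite {x. g x \<noteq> 0} \<and> l2norm g \<le> 1}"

definition op_norm :: "real \<Rightarrow> coeffs \<Rightarrow> real" where
  "op_norm \<theta> f = Sup (op_norm_set \<theta> f)"

definition in_A :: "real \<Rightarrow> coeffs \<Rightarrow> bool" where
  "in_A \<theta> f \<longleftrightarrow> (\<lambda>x. (cmod (f x))^2) summable_on UNIV \<and> bdd_above (op_norm_set \<theta> f) \<and>
     (\<exists>F :: nat \<Rightarrow> coeffs. (\<forall>k. finite {x. F k x \<noteq> 0}) \<and>
        (\<forall>k. bdd_above (op_norm_set \<theta> (\<lambda>x. F k x - f x))) \<and>
        (\<lambda>k. op_norm \<theta> (\<lambda>x. F k x - f x)) \<longlonglongrightarrow> 0)"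

definition smooth :: "coeffs \<Rightarrow> bool" where
  "smooth f \<longleftrightarrow> (\<forall>k::nat. bdd_above
      ((\<lambda>(m,n). (1 + real_of_int m ^ 2 + real_of_int n ^ 2) ^ k * (cmod (f (m,n)))^2) ` UNIV))"

definition invertible_A :: "real \<Rightarrow> coeffs \<Rightarrow> bool" where
  "invertible_A \<theta> x \<longleftrightarrow> (\<exists>y. in_A \<theta> y \<and> tw_mult \<theta> x y = one_c \<and> tw_mult \<theta> y x = one_c)"

definition spec :: "real \<Rightarrow> coeffs \<Rightarrow> complex set" where
  "spec \<theta> x = {c. \<not> invertible_A \<theta> (\<lambda>z. x z - c * one_c z)}"

definition strictly_pos :: "real \<Rightarrow> coeffs \<Rightarrow> bool" where
  "strictly_pos \<theta> a \<longleftrightarrow> in_A \<theta> a \<and> tw_star \<theta> a = a \<and>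
     spec \<theta> a \<subseteq> {c. \<exists>t::real. t > 0 \<and> c = complex_of_real t}"

fun tw_pow :: "real \<Rightarrow> coeffs \<Rightarrow> nat \<Rightarrow> coeffs" where
  "tw_pow \<theta> f 0 = one_c"
| "tw_pow \<theta> f (Suc k) = tw_mult \<theta> f (tw_pow \<theta> f k)"

definition poly_eval :: "real \<Rightarrow> real poly \<Rightarrow> coeffs \<Rightarrow> coeffs" where
  "poly_eval \<theta> p f = (\<lambda>x. \<Sum>i\<le>degree p. complex_of_real (coeff p i) * tw_pow \<theta> f i x)"

text \<open>Continuous functional calculus phi(x) for self-adjoint x: the element of
A_theta approximated in C*-norm by p(x) whenever the polynomial p approximates
phi uniformly on the spectrum.\<close>
definition cfc :: "real \<Rightarrow> (real \<Rightarrow> real) \<Rightarrow> coeffs \<Rightarrow> coeffs" where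
  "cfc \<theta> \<phi> x = (THE y. in_A \<theta> y \<and> (\<forall>\<epsilon>>0. \<exists>p::real poly.
       (\<forall>t. complex_of_real t \<in> spec \<theta> x \<longrightarrow> \<bar>\<phi> t - poly p t\<bar> \<le> \<epsilon>) \<and>
       bdd_above (op_norm_set \<theta> (\<lambda>z. y z - poly_eval \<theta> p x z)) \<and>
       op_norm \<theta> (\<lambda>z. y z - poly_eval \<theta> p x z) \<le> \<epsilon>))"

end

theory Submission
  imports Defs "HOL-Computational_Algebra.Fundamental_Theorem_Algebra"
begin

text \<open>
  The unitary \<open>W = U V\<^sup>s\<close> generates a commutative algebra, and \<open>a = \<Sum>\<^sub>n b\<^sub>n W\<^sup>n\<close> with
  \<open>|b\<^sub>n| = |a\<^sub>n|\<close>, so the claim is a logarithmic Sobolev inequality on the circle. As \<open>1 + |s| \<ge> 2\<close>,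
  twice the optimal constant is available. Put \<open>S = \<Sum> |b\<^sub>n|\<^sup>2\<close> and \<open>D = \<Sum> |n| |b\<^sub>n|\<^sup>2\<close>. Jensen's
  inequality, in the pointwise form \<open>ln t \<le> \<alpha> + \<beta> t\<^sup>2\<close> with suitable \<open>\<alpha>\<close> and \<open>\<beta>\<close>, reduces it to
  \<open>\<tau>(a\<^sup>4) \<le> S\<^sup>2 exp (4 D / S)\<close>, which follows from \<open>\<tau>(a\<^sup>4) \<le> S\<^sup>2 + 4 D S + 8 D\<^sup>2\<close>.
  For the latter, write the real function as \<open>f = Re H\<close> with \<open>H = b\<^sub>0 + 2 \<Sum>\<^bsub>n>0\<^esub> b\<^sub>n z\<^sup>n\<close>, integrate
  \<open>4 f\<^sup>4 \<le> 3 |H|\<^sup>4 + Re H\<^sup>4\<close>, and bound the coefficients of \<open>H\<^sup>2\<close> by Cauchy-Schwarz; integrals of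
  trigonometric polynomials are means over roots of unity.

  The functional calculus rests on the fact that a real polynomial \<open>q\<close> which is nonnegative on the
  spectrum of a symmetric operator \<open>T\<close> gives \<open>q(T) \<ge> 0\<close>: otherwise the infimum \<open>m < 0\<close> of the
  numerical range makes \<open>q(T) - m\<close> not bounded below, while factoring \<open>q - m\<close> into real linear and
  quadratic factors shows that it is.
\<close>

section \<open>Square-summable families\<close>

definition square_summable :: "('i \<Rightarrow> complex) \<Rightarrow> bool" where
  "square_summable f \<longleftrightarrow> (\<lambda>i. (cmod (f i))\<^sup>2) summable_on UNIV"

lemma square_summableI:
  assumes "\<And>F. finite F \<Longrightarrow> (\<Sum>i\<in>F. (cmod (f i))\<^sup>2) \<le> C"
  shows "square_summable f" "(\<Sum>\<^sub>\<infinity>i. (cmod (f i))\<^sup>2) \<le> C"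
proof -
  show s: "square_summable f"
    unfolding square_summable_def
    by (rule nonneg_bdd_above_summable_on) (auto intro!: bdd_aboveI2[of _ _ C] assms)
  show "(\<Sum>\<^sub>\<infinity>i. (cmod (f i))\<^sup>2) \<le> C"
    using s unfolding square_summable_def by (rule infsum_le_finite_sums) (use assms in auto)
qed

lemma square_summable_finite: "finite {i. f i \<noteq> 0} \<Longrightarrow> square_summable f"
  unfolding square_summable_def
  by (rule finite_nonzero_values_imp_summable_on) (simp add: Collect_mono)

lemma square_summable_add:
  assumes "square_summable f" "square_summable g"
  shows "square_summable (\<lambda>i. f i + g i)"
  unfolding square_summable_def
proof (rule summable_on_comparison_test)
  show "(\<lambda>i. 2 * (cmod (f i))\<^sup>2 + 2 * (cmod (g i))\<^sup>2) summable_on UNIV"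
    using assms unfolding square_summable_def
    by (intro summable_on_add summable_on_cmult_right)
  show "(cmod (f i + g i))\<^sup>2 \<le> 2 * (cmod (f i))\<^sup>2 + 2 * (cmod (g i))\<^sup>2" for i
  proof -
    have "(cmod (f i + g i))\<^sup>2 \<le> (cmod (f i) + cmod (g i))\<^sup>2"
      by (intro power_mono norm_triangle_ineq) auto
    also have "\<dots> \<le> 2 * (cmod (f i))\<^sup>2 + 2 * (cmod (g i))\<^sup>2"
      using sum_squares_bound[of "cmod (f i)" "cmod (g i)"] by (simp add: power2_sum)
    finally show ?thesis .
  qed
qed auto

lemma square_summable_cmult:
  assumes "square_summable f"
  shows "square_summable (\<lambda>i. c * f i)"
  using assms unfolding square_summable_def norm_mult power_mult_distrib
  by (rule summable_on_cmult_right)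

lemma square_summable_mono:
  assumes "square_summable f" "\<And>i. cmod (g i) \<le> cmod (f i)"
  shows "square_summable g"
  using assms(1) unfolding square_summable_def
  by (rule summable_on_comparison_test) (auto intro: power_mono assms(2))

lemma square_summable_inner:
  assumes "square_summable f" "square_summable g"
  shows "(\<lambda>i. f i \<bullet> g i) summable_on UNIV"
proof (rule abs_summable_summable, rule summable_on_comparison_test)
  show "(\<lambda>i. (cmod (f i))\<^sup>2 + (cmod (g i))\<^sup>2) summable_on UNIV"
    using assms unfolding square_summable_def by (rule summable_on_add)
  show "norm (f i \<bullet> g i) \<le> (cmod (f i))\<^sup>2 + (cmod (g i))\<^sup>2" for i
  proof -
    have "norm (f i \<bullet> g i) \<le> cmod (f i) * cmod (g i)"
      using Cauchy_Schwarz_ineq2 by auto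
    also have "\<dots> \<le> (cmod (f i))\<^sup>2 + (cmod (g i))\<^sup>2"
      using sum_squares_bound[of "cmod (f i)" "cmod (g i)"]
        mult_nonneg_nonneg[OF norm_ge_zero[of "f i"] norm_ge_zero[of "g i"]] by linarith
    finally show ?thesis .
  qed
qed auto

section \<open>The Hilbert space of square-summable families\<close>

typedef 'i ell2 = "{f :: 'i \<Rightarrow> complex. square_summable f}"
  morphisms coord Ell2
  by (rule exI[of _ "\<lambda>_. 0"]) (simp add: square_summable_def)

setup_lifting type_definition_ell2

lemma square_summable_coord: "square_summable (coord x)"
  using coord by auto

lemma coord_Ell2: "square_summable f \<Longrightarrow> coord (Ell2 f) = f"
  by (simp add: Ell2_inverse)

lemma ell2_eqI: "(\<And>i. coord x i = coord y i) \<Longrightarrow> x = y"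
  by (simp add: coord_inject[symmetric] fun_eq_iff)

text \<open>\<open>ell2\<close> is treated as a real Hilbert space: \<open>inner\<close> on complex
  numbers is the real part of the hermitian product, and the norm is the usual one.\<close>

instantiation ell2 :: (type) real_inner
begin

lift_definition zero_ell2 :: "'a ell2" is "\<lambda>_. 0"
  by (simp add: square_summable_def)

lift_definition plus_ell2 :: "'a ell2 \<Rightarrow> 'a ell2 \<Rightarrow> 'a ell2" is "\<lambda>f g i. f i + g i"
  by (rule square_summable_add)

lift_definition scaleR_ell2 :: "real \<Rightarrow> 'a ell2 \<Rightarrow> 'a ell2" is "\<lambda>c f i. of_real c * f i"
  by (rule square_summable_cmult)

lift_definition uminus_ell2 :: "'a ell2 \<Rightarrow> 'a ell2" is "\<lambda>f i. - f i"
  by (simp add: square_summable_def)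

lift_definition minus_ell2 :: "'a ell2 \<Rightarrow> 'a ell2 \<Rightarrow> 'a ell2" is "\<lambda>f g i. f i - g i"
  using square_summable_add[of _ "\<lambda>i. - _ i"] by (simp add: square_summable_def)

lift_definition inner_ell2 :: "'a ell2 \<Rightarrow> 'a ell2 \<Rightarrow> real" is
  "\<lambda>f g. \<Sum>\<^sub>\<infinity>i. f i \<bullet> g i" .

definition norm_ell2 :: "'a ell2 \<Rightarrow> real" where "norm_ell2 x = sqrt (x \<bullet> x)"
definition sgn_ell2 :: "'a ell2 \<Rightarrow> 'a ell2" where "sgn_ell2 x = scaleR (inverse (norm x)) x"
definition dist_ell2 :: "'a ell2 \<Rightarrow> 'a ell2 \<Rightarrow> real" where "dist_ell2 x y = norm (x - y)"
definition uniformity_ell2 :: "('a ell2 \<times> 'a ell2) filter" where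
  "uniformity_ell2 = (INF e\<in>{0<..}. principal {(x, y). dist x y < e})"
definition open_ell2 :: "'a ell2 set \<Rightarrow> bool" where
  "open_ell2 U \<longleftrightarrow> (\<forall>x\<in>U. \<forall>\<^sub>F (x', y) in uniformity. x' = x \<longrightarrow> y \<in> U)"

instance
proof
  fix x y z :: "'a ell2" and r s :: real
  show "x \<bullet> y = y \<bullet> x"
    by transfer (simp add: inner_commute)
  show "(x + y) \<bullet> z = x \<bullet> z + y \<bullet> z"
    by transfer (simp add: inner_left_distrib infsum_add square_summable_inner)
  show "(r *\<^sub>R x) \<bullet> y = r * (x \<bullet> y)"
    by transfer (simp flip: scaleR_conv_of_real infsum_cmult_right')
  show "0 \<le> x \<bullet> x"
    by transfer (simp add: infsum_nonneg)
  show "x \<bullet> x = 0 \<longleftrightarrow> x = 0"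
  proof transfer
    fix f :: "'a \<Rightarrow> complex" assume f: "square_summable f"
    show "(\<Sum>\<^sub>\<infinity>i. f i \<bullet> f i) = 0 \<longleftrightarrow> f = (\<lambda>_. 0)"
    proof
      assume "(\<Sum>\<^sub>\<infinity>i. f i \<bullet> f i) = 0"
      then have "f i \<bullet> f i = 0" for i
        by (intro nonneg_infsum_le_0D[of "\<lambda>i. f i \<bullet> f i" UNIV])
          (auto intro: square_summable_inner[OF f f])
      then show "f = (\<lambda>_. 0)" by (simp add: fun_eq_iff)
    qed simp
  qed
qed (simp_all add: sgn_ell2_def dist_ell2_def norm_ell2_def uniformity_ell2_def open_ell2_def,
     (transfer; simp add: algebra_simps fun_eq_iff)+)

end

lemma coord_simps [simp]:
  "coord 0 i = 0"
  "coord (x + y) i = coord x i + coord y i"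
  "coord (x - y) i = coord x i - coord y i"
  "coord (- x) i = - coord x i"
  "coord (c *\<^sub>R x) i = of_real c * coord x i"
  by (transfer; simp)+

lemma norm_ell2_sq: "(norm x)\<^sup>2 = (\<Sum>\<^sub>\<infinity>i. (cmod (coord x i))\<^sup>2)"
  unfolding power2_norm_eq_inner by transfer (simp add: power2_norm_eq_inner)

lemma finite_sum_le_norm_ell2: "finite F \<Longrightarrow> (\<Sum>i\<in>F. (cmod (coord x i))\<^sup>2) \<le> (norm x)\<^sup>2"
  unfolding norm_ell2_sq using square_summable_coord[of x]
  by (intro finite_sum_le_infsum) (auto simp: square_summable_def)

lemma cmod_coord_le: "cmod (coord x i) \<le> norm x"
  using finite_sum_le_norm_ell2[of "{i}" x] by (simp add: power2_le_iff_abs_le)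

lemma bounded_linear_coord: "bounded_linear (\<lambda>x. coord x i)"
  by (rule bounded_linear_intro[where K = 1]) (auto simp: cmod_coord_le scaleR_conv_of_real)

lemma coord_sum: "coord (\<Sum>k\<in>F. x k) i = (\<Sum>k\<in>F. coord (x k) i)"
  using linear_sum[OF bounded_linear.linear[OF bounded_linear_coord]] .

text \<open>Fatou's lemma for counting measure: every finite partial sum passes to the limit under
  the bound, and the total is the supremum of the finite sums.\<close>

lemma square_summable_Fatou:
  assumes "\<And>i. (\<lambda>n. coord (X n) i) \<longlonglongrightarrow> f i"
    and "\<forall>\<^sub>F n in sequentially. norm (X n) \<le> C"
  shows "square_summable f" "norm (Ell2 f) \<le> C"
proof -
  have fin: "(\<Sum>i\<in>F. (cmod (f i))\<^sup>2) \<le> C\<^sup>2" if "finite F" for F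
  proof (rule tendsto_upperbound)
    show "(\<lambda>n. \<Sum>i\<in>F. (cmod (coord (X n) i))\<^sup>2) \<longlonglongrightarrow> (\<Sum>i\<in>F. (cmod (f i))\<^sup>2)"
      by (intro tendsto_intros assms)
    show "\<forall>\<^sub>F n in sequentially. (\<Sum>i\<in>F. (cmod (coord (X n) i))\<^sup>2) \<le> C\<^sup>2"
      using assms(2)
    proof eventually_elim
      case (elim n)
      then show ?case
        using finite_sum_le_norm_ell2[OF that, of "X n"] power_mono[OF elim, of 2] by simp
    qed
  qed simp
  show s: "square_summable f" by (rule square_summableI(1)[OF fin])
  obtain n where "norm (X n) \<le> C" using eventually_happens[OF assms(2)] by auto
  then have "0 \<le> C" using norm_ge_zero order_trans by blast
  moreover have "(norm (Ell2 f))\<^sup>2 \<le> C\<^sup>2"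
    unfolding norm_ell2_sq coord_Ell2[OF s] by (rule square_summableI(2)[OF fin])
  ultimately show "norm (Ell2 f) \<le> C" by (simp add: power2_le_iff_abs_le)
qed

text \<open>A Cauchy sequence converges in each coordinate; Fatou applied to
  \<open>X m - X n\<close> with \<open>m\<close> fixed upgrades this to norm convergence.\<close>

instance ell2 :: (type) complete_space
proof
  fix X :: "nat \<Rightarrow> 'a ell2" assume X: "Cauchy X"
  define f where "f i = lim (\<lambda>n. coord (X n) i)" for i
  have lim: "(\<lambda>n. coord (X n) i) \<longlonglongrightarrow> f i" for i
    unfolding f_def using bounded_linear.Cauchy[OF bounded_linear_coord X]
    by (simp add: Cauchy_convergent_iff convergent_LIMSEQ_iff)
  obtain B where "\<And>n. norm (X n) \<le> B"
    using Cauchy_Bseq[OF X] by (auto simp: Bseq_def)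
  then have f: "square_summable f"
    using square_summable_Fatou(1)[OF lim, of B] by simp
  have "X \<longlonglongrightarrow> Ell2 f"
  proof (rule LIMSEQ_I)
    fix r :: real assume "r > 0"
    then obtain M where M: "\<And>m n. m \<ge> M \<Longrightarrow> n \<ge> M \<Longrightarrow> norm (X m - X n) < r / 2"
      using CauchyD[OF X, of "r / 2"] by auto
    have "norm (X m - Ell2 f) \<le> r / 2" if "m \<ge> M" for m
    proof -
      have "(\<lambda>n. coord (X m - X n) i) \<longlonglongrightarrow> coord (X m - Ell2 f) i" for i
        by (simp add: coord_Ell2 f) (intro tendsto_intros lim)
      moreover have "\<forall>\<^sub>F n in sequentially. norm (X m - X n) \<le> r / 2"
        using M[OF that] by (intro eventually_sequentiallyI[of M]) (auto intro: less_imp_le)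
      ultimately show ?thesis
        using square_summable_Fatou(2)[of "\<lambda>n. X m - X n" "coord (X m - Ell2 f)" "r / 2"]
        by (simp add: coord_inverse)
    qed
    then show "\<exists>no. \<forall>n\<ge>no. norm (X n - Ell2 f) < r"
      using \<open>r > 0\<close> by (intro exI[of _ M]) force
  qed
  then show "convergent X" by (auto simp: convergent_def)
qed

instance ell2 :: (type) banach ..

text \<open>The coefficient \<open>c\<close> is part of the vector because scalars are real here:
  real multiples of \<open>basis k 1\<close> alone do not fill a complex coordinate.\<close>

lift_definition basis :: "'i \<Rightarrow> complex \<Rightarrow> 'i ell2" is "\<lambda>k c i. if i = k then c else 0"
  by (rule square_summable_finite) (simp add: if_distrib)

lemma coord_basis [simp]: "coord (basis k c) i = (if i = k then c else 0)"
  by transfer simp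

lemma norm_basis [simp]: "norm (basis k c) = cmod c"
proof -
  have "(norm (basis k c))\<^sup>2 = (\<Sum>\<^sub>\<infinity>i\<in>{k}. (cmod c)\<^sup>2)"
    unfolding norm_ell2_sq by (rule infsum_cong_neutral) auto
  then show ?thesis by simp
qed

lemma inner_basis: "basis k c \<bullet> x = c \<bullet> coord x k"
proof -
  have "basis k c \<bullet> x = (\<Sum>\<^sub>\<infinity>i\<in>{k}. c \<bullet> coord x i)"
    unfolding inner_ell2.rep_eq by (rule infsum_cong_neutral) auto
  then show ?thesis by simp
qed

lemma finite_support_eq_sum_basis:
  assumes "finite F" "{i. coord x i \<noteq> 0} \<subseteq> F"
  shows "x = (\<Sum>k\<in>F. basis k (coord x k))"
proof (rule ell2_eqI)
  fix i show "coord x i = coord (\<Sum>k\<in>F. basis k (coord x k)) i"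
    using assms by (auto simp: coord_sum sum.delta)
qed

lemma inner_ell2_has_sum: "((\<lambda>i. coord x i \<bullet> coord y i) has_sum x \<bullet> y) UNIV"
  unfolding inner_ell2.rep_eq
  by (intro has_sum_infsum square_summable_inner square_summable_coord)

text \<open>Cut \<open>x\<close> down to a finite \<open>F\<close> carrying all but
  \<open>e\<^sup>2 / 2\<close> of its squared norm. The cut is an orthogonal projection, so the
  squared distance is the missing mass.\<close>

lemma closure_finite_support: "closure {x :: 'i ell2. finite {i. coord x i \<noteq> 0}} = UNIV"
proof (intro equalityI subset_UNIV subsetI)
  fix x :: "'i ell2"
  show "x \<in> closure {x. finite {i. coord x i \<noteq> 0}}"
    unfolding closure_approachable
  proof (intro allI impI)
    fix e :: real assume e: "0 < e"
    have hs: "((\<lambda>i. (cmod (coord x i))\<^sup>2) has_sum (norm x)\<^sup>2) UNIV"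
      using inner_ell2_has_sum[of x x] by (simp add: power2_norm_eq_inner)
    have e2: "0 < e\<^sup>2 / 2" using e by simp
    obtain F where F: "finite F" "dist (\<Sum>i\<in>F. (cmod (coord x i))\<^sup>2) ((norm x)\<^sup>2) \<le> e\<^sup>2 / 2"
      using has_sum_finite_approximation[OF hs e2] by blast
    define y where "y = (\<Sum>k\<in>F. basis k (coord x k))"
    have cy: "coord y i = (if i \<in> F then coord x i else 0)" for i
      using F(1) by (simp add: y_def coord_sum sum.delta)
    have xy: "x \<bullet> y = (\<Sum>i\<in>F. (cmod (coord x i))\<^sup>2)"
      by (simp add: y_def inner_sum_right inner_commute[of x] inner_basis power2_norm_eq_inner)
    have yy: "y \<bullet> y = (\<Sum>i\<in>F. (cmod (coord x i))\<^sup>2)"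
      unfolding y_def inner_sum_left
      by (simp add: inner_basis y_def[symmetric] cy power2_norm_eq_inner)
    have "(dist y x)\<^sup>2 = (norm x)\<^sup>2 - (\<Sum>i\<in>F. (cmod (coord x i))\<^sup>2)"
      unfolding dist_norm by (simp add: power2_norm_eq_inner inner_diff inner_commute[of y x] xy yy)
    also have "\<dots> \<le> e\<^sup>2 / 2" using F(2) unfolding dist_real_def by linarith
    also have "\<dots> < e\<^sup>2" using e2 by simp
    finally have "(dist y x)\<^sup>2 < e\<^sup>2" .
    then have "dist y x < e" using e by (simp add: power2_less_imp_less)
    moreover have "finite {i. coord y i \<noteq> 0}"
      using F(1) by (simp add: cy)
    ultimately show "\<exists>y\<in>{x. finite {i. coord x i \<noteq> 0}}. dist y x < e" by blast
  qed
qed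

lemma bounded_linear_eqI_basis:
  fixes f g :: "'i ell2 \<Rightarrow> 'b::real_normed_vector"
  assumes "bounded_linear f" "bounded_linear g" "\<And>k c. f (basis k c) = g (basis k c)"
  shows "f = g"
proof
  fix x :: "'i ell2"
  interpret f: bounded_linear f by fact
  interpret g: bounded_linear g by fact
  have "{x. finite {i. coord x i \<noteq> 0}} \<subseteq> {x. f x = g x}"
  proof (intro subsetI CollectI)
    fix y :: "'i ell2" assume "y \<in> {x. finite {i. coord x i \<noteq> 0}}"
    then have "y = (\<Sum>k | coord y k \<noteq> 0. basis k (coord y k))"
      by (intro finite_support_eq_sum_basis) auto
    then show "f y = g y" by (metis (no_types, lifting) assms(3) f.sum g.sum sum.cong)
  qed
  moreover have "closed {x. f x = g x}"
    by (intro closed_Collect_eq linear_continuous_on assms)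
  ultimately show "f x = g x" using closure_minimal closure_finite_support by blast
qed

section \<open>Polynomials of symmetric operators\<close>

primrec blinfun_pow :: "('a::real_normed_vector \<Rightarrow>\<^sub>L 'a) \<Rightarrow> nat \<Rightarrow> 'a \<Rightarrow>\<^sub>L 'a" where
  "blinfun_pow T 0 = id_blinfun"
| "blinfun_pow T (Suc n) = T o\<^sub>L blinfun_pow T n"

definition blinfun_poly :: "real poly \<Rightarrow> ('a::real_normed_vector \<Rightarrow>\<^sub>L 'a) \<Rightarrow> 'a \<Rightarrow>\<^sub>L 'a" where
  "blinfun_poly p T = (\<Sum>i\<le>degree p. coeff p i *\<^sub>R blinfun_pow T i)"

lemma blinfun_poly_0 [simp]: "blinfun_poly 0 T = 0"
  by (simp add: blinfun_poly_def)

lemma blinfun_compose_simps: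
  "(S + S') o\<^sub>L T = (S o\<^sub>L T) + (S' o\<^sub>L T)" "S o\<^sub>L (T + T') = (S o\<^sub>L T) + (S o\<^sub>L T')"
  "(c *\<^sub>R S) o\<^sub>L T = c *\<^sub>R (S o\<^sub>L T)" "S o\<^sub>L (c *\<^sub>R T) = c *\<^sub>R (S o\<^sub>L T)"
  "(S - S') o\<^sub>L T = (S o\<^sub>L T) - (S' o\<^sub>L T)" "S o\<^sub>L (T - T') = (S o\<^sub>L T) - (S o\<^sub>L T')"
  "id_blinfun o\<^sub>L T = T" "T o\<^sub>L id_blinfun = T"
  "(R o\<^sub>L S) o\<^sub>L T = R o\<^sub>L (S o\<^sub>L T)"
  by (rule blinfun_eqI; simp add: blinfun.bilinear_simps)+

text \<open>This Horner recursion makes the algebra of polynomial evaluation provable by induction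
  on \<open>pCons\<close>.\<close>

lemma blinfun_poly_pCons [simp]:
  "blinfun_poly (pCons c p) T = c *\<^sub>R id_blinfun + (T o\<^sub>L blinfun_poly p T)"
proof (cases "p = 0")
  case True
  then show ?thesis by (simp add: blinfun_poly_def)
next
  case False
  then show ?thesis
    by (simp add: blinfun_poly_def sum.atMost_Suc_shift blinfun_compose_simps
      bounded_bilinear.sum_right[OF bounded_bilinear_blinfun_compose] del: sum.atMost_Suc)
qed

lemma blinfun_poly_smult [simp]: "blinfun_poly (smult c p) T = c *\<^sub>R blinfun_poly p T"
  by (induction p) (simp_all add: blinfun_compose_simps algebra_simps)

lemma blinfun_poly_add [simp]: "blinfun_poly (p + q) T = blinfun_poly p T + blinfun_poly q T"
  by (induction p q rule: poly_induct2) (simp_all add: blinfun_compose_simps algebra_simps)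

lemma blinfun_poly_diff [simp]: "blinfun_poly (p - q) T = blinfun_poly p T - blinfun_poly q T"
  by (metis add_diff_cancel_right' blinfun_poly_add diff_add_cancel)

lemma blinfun_poly_mult [simp]: "blinfun_poly (p * q) T = blinfun_poly p T o\<^sub>L blinfun_poly q T"
  by (induction p) (simp_all add: blinfun_compose_simps)

definition symmetric_op :: "('a::real_inner \<Rightarrow>\<^sub>L 'a) \<Rightarrow> bool" where
  "symmetric_op T \<longleftrightarrow> (\<forall>x y. T x \<bullet> y = x \<bullet> T y)"

lemma symmetric_opD: "symmetric_op T \<Longrightarrow> T x \<bullet> y = x \<bullet> T y"
  by (simp add: symmetric_op_def)

lemma symmetric_op_poly:
  assumes "symmetric_op T"
  shows "symmetric_op (blinfun_poly p T)"
proof (induction p)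
  case (pCons c p)
  \<comment> \<open>\<open>T\<close> commutes with its polynomials because polynomials commute; a
    product of symmetric operators is symmetric exactly when the factors commute.\<close>
  have comm: "T (blinfun_poly p T x) = blinfun_poly p T (T x)" for x
  proof -
    have "blinfun_poly ([:0, 1:] * p) T = blinfun_poly (p * [:0, 1:]) T"
      by (simp add: mult.commute)
    then have "T o\<^sub>L blinfun_poly p T = blinfun_poly p T o\<^sub>L T"
      unfolding blinfun_poly_mult by (simp add: blinfun_compose_simps)
    then show ?thesis by (metis blinfun_apply_blinfun_compose)
  qed
  show ?case
    using pCons assms unfolding symmetric_op_def
    by (simp add: blinfun.bilinear_simps inner_add comm)
qed (simp add: symmetric_op_def)

section \<open>Operators bounded below and the approximate point spectrum\<close>

definition bounded_below :: "('a::real_normed_vector \<Rightarrow>\<^sub>L 'a) \<Rightarrow> bool" where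
  "bounded_below S \<longleftrightarrow> (\<exists>\<delta>>0. \<forall>x. \<delta> * norm x \<le> norm (S x))"

lemma bounded_belowI:
  fixes S :: "'a::real_normed_vector \<Rightarrow>\<^sub>L 'a"
  shows "0 < \<delta> \<Longrightarrow> (\<And>x. \<delta> * norm x \<le> norm (S x)) \<Longrightarrow> bounded_below S"
  by (auto simp: bounded_below_def)

lemma bounded_below_compose:
  assumes "bounded_below S" "bounded_below T"
  shows "bounded_below (S o\<^sub>L T)"
proof -
  obtain c d where c: "c > 0" "\<And>x. c * norm x \<le> norm (S x)" and d: "d > 0" "\<And>x. d * norm x \<le> norm (T x)"
    using assms by (auto simp: bounded_below_def)
  show ?thesis
  proof (rule bounded_belowI[of "c * d"])
    fix x
    have "c * d * norm x \<le> c * norm (T x)" using c(1) d(2)[of x] by simp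
    also have "\<dots> \<le> norm (S (T x))" by (rule c)
    finally show "c * d * norm x \<le> norm ((S o\<^sub>L T) x)" by simp
  qed (use c d in simp)
qed

text \<open>The real points of the approximate point spectrum. It is phrased by lower bounds rather
  than inverses, and these are easily followed through products and perturbations.\<close>

definition approx_spectrum :: "('a::real_normed_vector \<Rightarrow>\<^sub>L 'a) \<Rightarrow> real set" where
  "approx_spectrum T = {t. \<not> bounded_below (T - t *\<^sub>R id_blinfun)}"

text \<open>The polynomial is \<open>(t - u)\<^sup>2 + v\<^sup>2\<close>, and the square of the
  symmetric operator \<open>T - u\<close> adds a nonnegative amount to the quadratic form.
  Cauchy-Schwarz turns the bound on the form into one on the norm.\<close>

lemma bounded_below_quadratic:
  assumes "symmetric_op T" "v \<noteq> 0"
  shows "bounded_below (blinfun_poly [:u\<^sup>2 + v\<^sup>2, - 2 * u, 1:] T)"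
proof (rule bounded_belowI[of "v\<^sup>2"])
  fix x
  define S where "S = blinfun_poly [:u\<^sup>2 + v\<^sup>2, - 2 * u, 1:] T"
  have "v\<^sup>2 * (norm x)\<^sup>2 \<le> v\<^sup>2 * (norm x)\<^sup>2 + (norm (T x - u *\<^sub>R x))\<^sup>2" by simp
  also have "\<dots> = S x \<bullet> x"
    unfolding power2_norm_eq_inner S_def
    by (simp add: blinfun.bilinear_simps inner_simps symmetric_opD[OF assms(1)] inner_commute
        power2_eq_square algebra_simps)
  also have "\<dots> \<le> norm (S x) * norm x" by (rule norm_cauchy_schwarz)
  finally have "v\<^sup>2 * norm x * norm x \<le> norm (S x) * norm x"
    by (simp add: power2_eq_square mult.assoc)
  then show "v\<^sup>2 * norm x \<le> norm (S x)"
    by (cases "norm x = 0") (auto simp: mult_le_cancel_right)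
qed (use assms in simp)

lemma map_poly_of_real_mult:
  "map_poly complex_of_real (p * q) = map_poly complex_of_real p * map_poly complex_of_real q"
  by (rule poly_eqI) (simp add: coeff_map_poly coeff_mult)

lemma map_poly_of_real_add:
  "map_poly complex_of_real (p + q) = map_poly complex_of_real p + map_poly complex_of_real q"
  by (rule poly_eqI) (simp add: coeff_map_poly)

lemma of_real_poly: "complex_of_real (poly p x) = poly (map_poly complex_of_real p) (of_real x)"
  by (induction p) (auto simp: map_poly_pCons)

text \<open>Induction on the degree, splitting off one real factor at a time: a linear factor at a
  real root, which lies outside \<open>approx_spectrum T\<close>, or the quadratic factor of a pair
  of conjugate roots.\<close>

lemma bounded_below_poly:
  assumes T: "symmetric_op T"
  shows "p \<noteq> 0 \<Longrightarrow> (\<And>t. t \<in> approx_spectrum T \<Longrightarrow> poly p t \<noteq> 0) \<Longrightarrow> bounded_below (blinfun_poly p T)"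
proof (induction "degree p" arbitrary: p rule: less_induct)
  case less
  have factor: "bounded_below (blinfun_poly p T)"
    if p: "p = d * r" and d: "degree d > 0" and bb: "bounded_below (blinfun_poly d T)" for d r
  proof -
    have nz: "d \<noteq> 0" "r \<noteq> 0" using less.prems(1) p by auto
    have "bounded_below (blinfun_poly r T)"
    proof (rule less.hyps)
      show "degree r < degree p" using nz d by (simp add: p degree_mult_eq)
      show "poly r t \<noteq> 0" if "t \<in> approx_spectrum T" for t
        using less.prems(2)[OF that] p by auto
    qed fact
    with bb show ?thesis by (simp add: p bounded_below_compose)
  qed
  show ?case
  proof (cases "degree p = 0")
    case True
    then obtain c where p: "p = [:c:]" by (rule degree_eq_zeroE)
    with less.prems have "c \<noteq> 0" by auto
    then show ?thesis
      by (intro bounded_belowI[of "\<bar>c\<bar>"]) (auto simp: p blinfun.bilinear_simps)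
  next
    case False
    define P where "P = map_poly complex_of_real p"
    have "degree P = degree p" by (simp add: P_def degree_map_poly)
    then obtain z where z: "poly P z = 0"
      using False fundamental_theorem_of_algebra[of P] by (auto simp: constant_degree)
    show ?thesis
    proof (cases "Im z = 0")
      case True
      then have "z = of_real (Re z)" by (simp add: complex_eq_iff)
      then have root: "poly p (Re z) = 0" using z 
        unfolding P_def by (metis of_real_eq_0_iff of_real_poly)
      then obtain r where "p = [:- Re z, 1:] * r" unfolding poly_eq_0_iff_dvd by (rule dvdE)
      moreover have "Re z \<notin> approx_spectrum T" using less.prems(2) root by blast
      then have "bounded_below (blinfun_poly [:- Re z, 1:] T)"
        by (simp add: approx_spectrum_def blinfun_compose_simps add.commute[of "- _"])
      ultimately show ?thesis using factor[of "[:- Re z, 1:]" r] by simp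
    next
      case False
      \<comment> \<open>\<open>d\<close> is \<open>(t - z) (t - cnj z)\<close> written with real
        coefficients.\<close>
      define d where "d = [:(Re z)\<^sup>2 + (Im z)\<^sup>2, - 2 * Re z, 1:]"
      have dz: "poly (map_poly complex_of_real d) z = 0"
        by (simp add: d_def map_poly_pCons complex_eq_iff power2_eq_square algebra_simps)
      have "P = map_poly complex_of_real d * map_poly complex_of_real (p div d)
          + map_poly complex_of_real (p mod d)"
        by (simp add: P_def flip: map_poly_of_real_mult map_poly_of_real_add)
      then have rz: "poly (map_poly complex_of_real (p mod d)) z = 0"
        using z dz by simp
      \<comment> \<open>The remainder is real of degree at most one and vanishes at the nonreal
        \<open>z\<close>, so both its coefficients are zero.\<close>
      have "degree (p mod d) < 2"
        using degree_mod_less[of d p] by (auto simp: d_def)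
      then obtain b c where bc: "p mod d = [:b, c:]"
        by (metis One_nat_def degree_eq_zeroE degree_pCons_eq_if less_2_cases pCons_cases pCons_0_0 nat.inject)
      with rz have "b = 0" "c = 0" using False by (auto simp: map_poly_pCons complex_eq_iff)
      then have p: "p = d * (p div d)" using bc by (metis add.right_neutral mult_div_mod_eq pCons_0_0)
      have "bounded_below (blinfun_poly d T)"
        unfolding d_def by (rule bounded_below_quadratic[OF T False])
      then show ?thesis by (intro factor[OF p]) (simp_all add: d_def)
    qed
  qed
qed

text \<open>\<open>m\<close> is the infimum of the numerical range, so \<open>R = S - m\<close> has
  a nonnegative form, which then dominates a multiple of \<open>(norm (R x))\<^sup>2\<close>. Were
  \<open>R\<close> bounded below, the form would stay away from zero on unit vectors and
  \<open>m\<close> could be raised.\<close>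

lemma Inf_quadratic_form_in_approx_spectrum:
  fixes S :: "'a::real_inner \<Rightarrow>\<^sub>L 'a"
  assumes S: "symmetric_op S" and z: "z \<noteq> (0::'a)"
  obtains m where "m \<in> approx_spectrum S" "\<And>x. m * (norm x)\<^sup>2 \<le> S x \<bullet> x"
proof -
  define W where "W = {S x \<bullet> x | x. norm x = 1}"
  define m where "m = Inf W"
  have ne: "W \<noteq> {}" using z by (auto simp: W_def intro!: exI[of _ "z /\<^sub>R norm z"])
  have "- norm S \<le> S x \<bullet> x" if "norm x = 1" for x
    using Cauchy_Schwarz_ineq2[of "S x" x] norm_blinfun[of S x] that by simp
  then have bdd: "bdd_below W" by (intro bdd_belowI[of _ "- norm S"]) (auto simp: W_def)
  have m: "m * (norm x)\<^sup>2 \<le> S x \<bullet> x" for x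
  proof (cases "x = 0")
    case False
    let ?y = "x /\<^sub>R norm x"
    have "m \<le> S ?y \<bullet> ?y"
      unfolding m_def W_def using False
      by (intro cInf_lower bdd[unfolded W_def] CollectI exI[of _ ?y] conjI) simp_all
    also have "\<dots> = (S x \<bullet> x) / (norm x)\<^sup>2"
      by (simp add: blinfun.bilinear_simps power2_eq_square divide_simps)
    finally show ?thesis using False by (simp add: pos_le_divide_eq)
  qed simp
  define R where "R = S - m *\<^sub>R id_blinfun"
  have R: "0 \<le> R x \<bullet> x" for x
    using m[of x] by (simp add: R_def blinfun.bilinear_simps inner_diff power2_norm_eq_inner)
  have Rsym: "symmetric_op R"
    using S by (simp add: symmetric_op_def R_def blinfun.bilinear_simps inner_diff)
  \<comment> \<open>Any positive \<open>t\<close> with \<open>t * norm R \<le> 1\<close> serves; the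
    added one keeps the denominator positive when \<open>R = 0\<close>.\<close>
  define t where "t = 1 / (norm R + 1)"
  have t: "t > 0" "t * norm R \<le> 1" by (auto simp: t_def add_nonneg_pos)
  \<comment> \<open>Nonnegativity is tested at \<open>x - t R x\<close>, a gradient step for the
    form; the term quadratic in \<open>t\<close> is absorbed by the choice of
    \<open>t\<close>.\<close>
  have key: "t * (norm (R x))\<^sup>2 \<le> R x \<bullet> x" for x
  proof -
    have "0 \<le> R (x - t *\<^sub>R R x) \<bullet> (x - t *\<^sub>R R x)" by (rule R)
    also have "\<dots> = R x \<bullet> x - 2 * t * (norm (R x))\<^sup>2 + t\<^sup>2 * (R (R x) \<bullet> R x)"
      using symmetric_opD[OF Rsym, of "R x" x]
      by (simp add: blinfun.bilinear_simps inner_simps power2_eq_square[of t] dot_square_norm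
          algebra_simps)
    also have "t\<^sup>2 * (R (R x) \<bullet> R x) \<le> t\<^sup>2 * (norm R * (norm (R x))\<^sup>2)"
    proof (rule mult_left_mono)
      have "R (R x) \<bullet> R x \<le> norm (R (R x)) * norm (R x)" by (rule norm_cauchy_schwarz)
      also have "\<dots> \<le> norm R * norm (R x) * norm (R x)"
        by (intro mult_right_mono norm_blinfun) auto
      finally show "R (R x) \<bullet> R x \<le> norm R * (norm (R x))\<^sup>2"
        by (simp add: power2_eq_square mult.assoc)
    qed simp
    also have "\<dots> = t * (t * norm R) * (norm (R x))\<^sup>2" by (simp add: power2_eq_square)
    also have "\<dots> \<le> t * 1 * (norm (R x))\<^sup>2"
      using t by (intro mult_right_mono mult_left_mono) auto
    finally show ?thesis by simp
  qed
  have "\<not> bounded_below R"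
  proof
    assume "bounded_below R"
    then obtain d where d: "d > 0" "\<And>x. d * norm x \<le> norm (R x)"
      by (auto simp: bounded_below_def)
    have "m + t * d\<^sup>2 \<le> w" if w: "w \<in> W" for w
    proof -
      obtain x where x: "w = S x \<bullet> x" "norm x = 1" using w by (auto simp: W_def)
      have "d\<^sup>2 \<le> (norm (R x))\<^sup>2" using d(2)[of x] d(1) x(2) by (intro power_mono) auto
      then have "t * d\<^sup>2 \<le> t * (norm (R x))\<^sup>2" using t by simp
      also have "\<dots> \<le> R x \<bullet> x" by (rule key)
      also have "\<dots> = w - m"
        using x by (simp add: R_def blinfun.bilinear_simps inner_diff flip: power2_norm_eq_inner)
      finally show ?thesis by simp
    qed
    then have "m + t * d\<^sup>2 \<le> m" unfolding m_def using ne by (intro cInf_greatest)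
    then show False using t d by (simp add: mult_le_0_iff not_less[symmetric])
  qed
  then show ?thesis using m that[of m] by (simp add: approx_spectrum_def R_def)
qed

theorem blinfun_poly_nonneg:
  fixes T :: "'a::real_inner \<Rightarrow>\<^sub>L 'a"
  assumes T: "symmetric_op T" and q: "\<And>t. t \<in> approx_spectrum T \<Longrightarrow> 0 \<le> poly q t"
  shows "0 \<le> blinfun_poly q T x \<bullet> x"
proof (cases "x = 0")
  case False
  obtain t0 where t0: "t0 \<in> approx_spectrum T"
    using Inf_quadratic_form_in_approx_spectrum[OF T False] by blast
  obtain m where m: "m \<in> approx_spectrum (blinfun_poly q T)"
    "\<And>x. m * (norm x)\<^sup>2 \<le> blinfun_poly q T x \<bullet> x"
    using Inf_quadratic_form_in_approx_spectrum[OF symmetric_op_poly[OF T] False] by blast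
  have "\<not> bounded_below (blinfun_poly (q - [:m:]) T)"
    using m(1) by (simp add: approx_spectrum_def)
  \<comment> \<open>A spectral point \<open>t0\<close> exists since the space is nonzero; it
    excludes that \<open>q\<close> is the negative constant \<open>m\<close>, the case outside
    \<open>bounded_below_poly\<close>.\<close>
  moreover have "q - [:m:] \<noteq> 0" if "m < 0"
    using q[OF t0] that by auto
  ultimately have "0 \<le> m"
    using bounded_below_poly[OF T, of "q - [:m:]"] q by force
  then have "0 \<le> m * (norm x)\<^sup>2" by simp
  with m(2) show ?thesis using order_trans by blast
qed simp

text \<open>Positivity is applied to \<open>M\<^sup>2 - q\<^sup>2\<close>, whose form at
  \<open>x\<close> is the difference of the squares of \<open>M * norm x\<close> and of the norm of
  \<open>q(T) x\<close>.\<close>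

corollary norm_blinfun_poly_le:
  fixes T :: "'a::real_inner \<Rightarrow>\<^sub>L 'a"
  assumes T: "symmetric_op T" and M: "0 \<le> M" "\<And>t. t \<in> approx_spectrum T \<Longrightarrow> \<bar>poly q t\<bar> \<le> M"
  shows "norm (blinfun_poly q T) \<le> M"
proof (rule norm_blinfun_bound[OF M(1)])
  fix x
  have "0 \<le> blinfun_poly ([:M\<^sup>2:] - q * q) T x \<bullet> x"
  proof (rule blinfun_poly_nonneg[OF T])
    fix t assume "t \<in> approx_spectrum T"
    then have "\<bar>poly q t\<bar>\<^sup>2 \<le> M\<^sup>2" using M by (intro power_mono) auto
    then show "0 \<le> poly ([:M\<^sup>2:] - q * q) t" by (simp add: power2_eq_square)
  qed
  also have "\<dots> = (M * norm x)\<^sup>2 - (norm (blinfun_poly q T x))\<^sup>2"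
    by (simp add: blinfun.bilinear_simps inner_diff power_mult_distrib power2_norm_eq_inner
        symmetric_opD[OF symmetric_op_poly[OF T]])
  finally show "norm (blinfun_poly q T x) \<le> M * norm x"
    using M(1) by (simp add: power2_le_iff_abs_le)
qed

section \<open>Perturbation of lower bounds\<close>

lemma bounded_below_perturb:
  fixes S S' :: "'a::real_normed_vector \<Rightarrow>\<^sub>L 'a"
  assumes d: "\<And>x. d * norm x \<le> norm (S x)" and "norm (S' - S) < d"
  shows "bounded_below S'"
proof (rule bounded_belowI)
  fix x
  have "norm (S x) - norm (S' x) \<le> norm ((S' - S) x)"
    unfolding blinfun.diff_left using norm_triangle_ineq3[of "S' x" "S x"] by linarith
  also have "\<dots> \<le> norm (S' - S) * norm x" by (rule norm_blinfun)
  finally show "(d - norm (S' - S)) * norm x \<le> norm (S' x)"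
    using d[of x] by (simp add: left_diff_distrib)
qed (use assms in simp)

lemma norm_id_blinfun_le: "norm (id_blinfun :: 'a::real_normed_vector \<Rightarrow>\<^sub>L 'a) \<le> 1"
  by (rule norm_blinfun_bound) auto

text \<open>Boundedness and closedness are both perturbation statements: \<open>T - t\<close>
  perturbs \<open>- t\<close> by \<open>T\<close>, which is harmless for
  \<open>\<bar>t\<bar> > norm T\<close>, and it perturbs \<open>T - t'\<close> by a small multiple
  of the identity for \<open>t'\<close> near \<open>t\<close>.\<close>

lemma compact_approx_spectrum:
  fixes T :: "'a::real_normed_vector \<Rightarrow>\<^sub>L 'a"
  shows "compact (approx_spectrum T)"
proof -
  have "bounded_below (T - t *\<^sub>R id_blinfun)" if "\<bar>t\<bar> > norm T" for t
  proof (rule bounded_below_perturb)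
    show "\<bar>t\<bar> * norm x \<le> norm (((- t) *\<^sub>R id_blinfun :: 'a \<Rightarrow>\<^sub>L 'a) x)" for x :: 'a
      by (simp add: blinfun.bilinear_simps)
  qed (use that in simp)
  then have "approx_spectrum T \<subseteq> cball 0 (norm T)"
    by (force simp: approx_spectrum_def)
  moreover have "open (- approx_spectrum T)"
    unfolding open_dist
  proof
    fix t assume "t \<in> - approx_spectrum T"
    then obtain d where d: "d > 0" "\<And>x. d * norm x \<le> norm ((T - t *\<^sub>R id_blinfun) x)"
      by (auto simp: approx_spectrum_def bounded_below_def)
    have "bounded_below (T - t' *\<^sub>R id_blinfun)" if "dist t' t < d" for t'
    proof (rule bounded_below_perturb[OF d(2)])
      have "norm (T - t' *\<^sub>R id_blinfun - (T - t *\<^sub>R id_blinfun)) = norm ((t - t') *\<^sub>R (id_blinfun :: 'a \<Rightarrow>\<^sub>L 'a))"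
        by (simp add: algebra_simps)
      also have "\<dots> \<le> \<bar>t - t'\<bar> * 1"
        unfolding norm_scaleR by (intro mult_left_mono norm_id_blinfun_le) auto
      finally show "norm (T - t' *\<^sub>R id_blinfun - (T - t *\<^sub>R id_blinfun)) < d"
        using that by (simp add: dist_real_def abs_minus_commute)
    qed
    then show "\<exists>e>0. \<forall>y. dist y t < e \<longrightarrow> y \<in> - approx_spectrum T"
      using d(1) by (auto simp: approx_spectrum_def)
  qed
  ultimately show ?thesis
    by (meson bounded_subset bounded_cball closed_def compact_eq_bounded_closed)
qed

section \<open>Convolution squares of hermitian sequences\<close>

lemma roots_of_unity_orthogonality:
  assumes "i < M" "k < M"
  shows "(\<Sum>j<M. cis (2 * pi / M) ^ (j * i) * cnj (cis (2 * pi / M) ^ (j * k))) = (if i = k then of_nat M else 0)"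
proof -
  \<comment> \<open>\<open>u\<close> is an \<open>M\<close>-th root of unity. It differs from one
    when \<open>i\<close> and \<open>k\<close> differ, since their distance is smaller than
    \<open>M\<close>; the geometric sum then vanishes.\<close>
  define u where "u = cis (2 * pi / M * (real i - real k))"
  have t: "cis (2 * pi / M) ^ (j * i) * cnj (cis (2 * pi / M) ^ (j * k)) = u ^ j" for j
    unfolding u_def Complex.DeMoivre cis_cnj cis_mult
    by (rule arg_cong[of _ _ cis]) (simp add: right_diff_distrib diff_divide_distrib mult_ac)
  show ?thesis
  proof (cases "i = k")
    case True
    then show ?thesis unfolding t by (simp add: u_def)
  next
    case False
    have "u \<noteq> 1"
    proof
      assume "u = 1"
      then have "cos (2 * pi / M * (real i - real k)) = 1"
        unfolding u_def by (simp add: complex_eq_iff)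
      then obtain n :: int where *: "2 * pi / M * (real i - real k) = real_of_int n * 2 * pi"
        unfolding cos_one_2pi_int by blast
      then have "real i - real k = real_of_int n * real M" 
      proof -
        have "pi * 2 * (real i - real k) = pi * 2 * (real_of_int n * real M)"
          using * assms by (simp add: field_simps)
        then show ?thesis by simp
      qed
      then have "int i - int k = n * int M" by (metis of_int_eq_iff of_int_diff of_int_mult of_int_of_nat_eq)
      then have "int M dvd int i - int k" by simp
      moreover have "\<bar>int i - int k\<bar> < int M" using assms by linarith
      ultimately show False using False zdvd_imp_le[of "int M" "\<bar>int i - int k\<bar>"] by auto
    qed
    moreover have "u ^ M = 1"
    proof -
      have "u ^ M = cis (2 * pi * of_int (int i - int k))"
        using assms by (simp add: u_def Complex.DeMoivre)
      then show ?thesis by (simp only: cis_multiple_2pi Ints_of_int)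
    qed
    ultimately show ?thesis
      unfolding t using False by (simp add: geometric_sum)
  qed
qed

lemma poly_sum_lessThan:
  fixes Q :: "complex poly"
  assumes "degree Q < M"
  shows "poly Q x = (\<Sum>i<M. coeff Q i * x ^ i)"
proof -
  have "poly Q x = (\<Sum>i\<le>degree Q. coeff Q i * x ^ i)" by (rule poly_altdef)
  also have "\<dots> = (\<Sum>i<M. coeff Q i * x ^ i)"
    using assms by (intro sum.mono_neutral_left) (auto simp: coeff_eq_0)
  finally show ?thesis .
qed

text \<open>Discrete Parseval: \<open>degree Q < M\<close> excludes aliasing, so distinct exponents
  remain orthogonal on the sample points.\<close>

lemma poly_parseval:
  assumes "degree Q < M"
  shows "(\<Sum>j<M. (cmod (poly Q (cis (2 * pi / M) ^ j)))\<^sup>2) = M * (\<Sum>i<M. (cmod (coeff Q i))\<^sup>2)"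
proof -
  let ?w = "cis (2 * pi / M)"
  have "complex_of_real (\<Sum>j<M. (cmod (poly Q (?w ^ j)))\<^sup>2) = (\<Sum>j<M. poly Q (?w ^ j) * cnj (poly Q (?w ^ j)))"
    by (simp only: of_real_sum complex_norm_square)
  also have "\<dots> = (\<Sum>j<M. \<Sum>i<M. \<Sum>k<M. (coeff Q i * cnj (coeff Q k)) * (?w ^ (j * i) * cnj (?w ^ (j * k))))"
    by (simp add: poly_sum_lessThan[OF assms] sum_product power_mult mult_ac)
  also have "\<dots> = (\<Sum>i<M. \<Sum>j<M. \<Sum>k<M. (coeff Q i * cnj (coeff Q k)) * (?w ^ (j * i) * cnj (?w ^ (j * k))))"
    by (rule sum.swap)
  also have "\<dots> = (\<Sum>i<M. \<Sum>k<M. \<Sum>j<M. (coeff Q i * cnj (coeff Q k)) * (?w ^ (j * i) * cnj (?w ^ (j * k))))"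
    by (intro sum.cong refl sum.swap)
  also have "\<dots> = (\<Sum>i<M. \<Sum>k<M. (coeff Q i * cnj (coeff Q k)) * (if i = k then of_nat M else 0))"
    unfolding sum_distrib_left[symmetric] using roots_of_unity_orthogonality by (intro sum.cong refl) simp
  also have "\<dots> = (\<Sum>i<M. coeff Q i * cnj (coeff Q i) * of_nat M)"
    by (intro sum.cong refl) (simp add: if_distrib cong: if_cong)
  also have "\<dots> = complex_of_real (M * (\<Sum>i<M. (cmod (coeff Q i))\<^sup>2))"
    by (simp only: of_real_mult of_real_sum complex_norm_square sum_distrib_left) (simp add: mult_ac)
  finally show ?thesis by (simp only: of_real_eq_iff)
qed

text \<open>Averaging is pairing with the constant monomial, so only the exponent zero
  survives.\<close>

lemma poly_mean_roots_of_unity: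
  assumes "degree Q < M"
  shows "(\<Sum>j<M. poly Q (cis (2 * pi / M) ^ j)) = M * coeff Q 0"
proof -
  let ?w = "cis (2 * pi / M)"
  have M: "0 < M" using assms by simp
  have "(\<Sum>j<M. poly Q (?w ^ j)) = (\<Sum>j<M. \<Sum>i<M. coeff Q i * (?w ^ (j * i) * cnj (?w ^ (j * 0))))"
    by (simp add: poly_sum_lessThan[OF assms] power_mult)
  also have "\<dots> = (\<Sum>i<M. \<Sum>j<M. coeff Q i * (?w ^ (j * i) * cnj (?w ^ (j * 0))))"
    by (rule sum.swap)
  also have "\<dots> = (\<Sum>i<M. coeff Q i * (if i = 0 then of_nat M else 0))"
    unfolding sum_distrib_left[symmetric] using roots_of_unity_orthogonality[OF _ M]
    by (intro sum.cong refl) simp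
  also have "\<dots> = M * coeff Q 0" using M by (simp add: if_distrib cong: if_cong)
  finally show ?thesis .
qed

text \<open>The coefficient of index \<open>k\<close> has \<open>k + 1\<close> summands, and
  Cauchy-Schwarz costs that factor. Splitting it as \<open>1 + i + (k - i)\<close> distributes it
  over the two factors, where it becomes a first moment of \<open>u\<close>.\<close>

lemma sum_coeff_square_le:
  fixes P :: "complex poly"
  defines "u \<equiv> \<lambda>i. (cmod (coeff P i))\<^sup>2"
  shows "(\<Sum>k<M. (cmod (coeff (P * P) k))\<^sup>2) \<le> (\<Sum>i<M. u i) * ((\<Sum>i<M. u i) + 2 * (\<Sum>i<M. real i * u i))"
proof -
  have u0: "0 \<le> u i" for i by (simp add: u_def)
  have "(cmod (coeff (P * P) k))\<^sup>2 \<le> (\<Sum>i\<le>k. (1 + real i + real (k - i)) * (u i * u (k - i)))" for k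
  proof -
    have "(cmod (coeff (P * P) k))\<^sup>2 \<le> (\<Sum>i\<le>k. 1 * cmod (coeff P i * coeff P (k - i)))\<^sup>2"
      unfolding coeff_mult by (intro power_mono) (auto intro: norm_sum)
    also have "\<dots> \<le> (\<Sum>i\<le>k. 1\<^sup>2) * (\<Sum>i\<le>k. (cmod (coeff P i * coeff P (k - i)))\<^sup>2)"
      by (rule Cauchy_Schwarz_ineq_sum)
    also have "\<dots> = (\<Sum>i\<le>k. (1 + real i + real (k - i)) * (u i * u (k - i)))"
      unfolding sum_distrib_left
      by (intro sum.cong refl) (simp add: u_def norm_mult power_mult_distrib of_nat_diff)
    finally show ?thesis .
  qed
  then have "(\<Sum>k<M. (cmod (coeff (P * P) k))\<^sup>2) \<le> (\<Sum>k<M. \<Sum>i\<le>k. (1 + real i + real (k - i)) * (u i * u (k - i)))"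
    by (rule sum_mono)
  also have "\<dots> = (\<Sum>(i,j)\<in>{(i,j). i + j < M}. (1 + real i + real j) * (u i * u j))"
    by (rule sum.triangle_reindex[symmetric])
  \<comment> \<open>The triangle is enlarged to the full square, over which the sum factors.\<close>
  also have "\<dots> \<le> (\<Sum>(i,j)\<in>{..<M} \<times> {..<M}. (1 + real i + real j) * (u i * u j))"
    by (rule sum_mono2) (auto simp: u0)
  also have "\<dots> = (\<Sum>i<M. \<Sum>j<M. u i * u j + (real i * u i) * u j + u i * (real j * u j))"
    by (simp add: sum.cartesian_product algebra_simps)
  also have "\<dots> = (\<Sum>i<M. u i) * ((\<Sum>i<M. u i) + 2 * (\<Sum>i<M. real i * u i))"
    by (simp only: sum.distrib sum_product[symmetric]) (simp add: algebra_simps)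
  finally show ?thesis .
qed

section \<open>Fourth powers of real trigonometric polynomials\<close>

lemma sum_int_symmetric:
  fixes f :: "int \<Rightarrow> 'a::comm_monoid_add"
  shows "(\<Sum>n\<in>{- int N..int N}. f n) = f 0 + (\<Sum>n=1..N. f (int n) + f (- int n))"
proof (induction N)
  case (Suc N)
  have "{- int (Suc N)..int (Suc N)} = insert (int (Suc N)) (insert (- int (Suc N)) {- int N..int N})"
    by auto
  then show ?case using Suc by (simp add: add_ac)
qed simp

text \<open>The two sides differ by \<open>4 * (Im z) ^ 4\<close>. The gain is that
  \<open>Re (z ^ 4)\<close> is harmonic, so its mean is read off from one coefficient.\<close>

lemma real_part_power4_le: "4 * (Re z) ^ 4 \<le> 3 * (cmod z) ^ 4 + Re (z ^ 4)"
proof -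
  have "(cmod z) ^ 4 = ((Re z)\<^sup>2 + (Im z)\<^sup>2)\<^sup>2"
    by (metis cmod_power2 mult_2 numeral_Bit0 power2_eq_square power_add)
  moreover have "Re (z ^ 4) = (Re z) ^ 4 - 6 * (Re z)\<^sup>2 * (Im z)\<^sup>2 + (Im z) ^ 4"
    by (simp add: eval_nat_numeral algebra_simps)
  ultimately have "3 * (cmod z) ^ 4 + Re (z ^ 4) = 4 * (Re z) ^ 4 + 4 * (Im z) ^ 4"
    by (simp add: eval_nat_numeral algebra_simps)
  then show ?thesis by simp
qed

text \<open>On the unit circle the factor \<open>z ^ N\<close> turns the trigonometric polynomial
  into an ordinary one of the same modulus. Hermitian symmetry makes the terms at \<open>n\<close>
  and \<open>- n\<close> conjugate, so the sum is the real part of its analytic half with the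
  coefficients at positive indices doubled.\<close>

lemma hermitian_poly_eq_Re:
  fixes c :: "int \<Rightarrow> complex"
  assumes herm: "\<And>n. c (- n) = cnj (c n)" and z: "cmod z = 1"
  shows "cmod (\<Sum>i\<le>2 * N. c (int i - int N) * z ^ i)
    = \<bar>Re (\<Sum>i\<le>N. (if i = 0 then c 0 else 2 * c (int i)) * z ^ i)\<bar>"
proof -
  define A where "A = (\<Sum>n=1..N. c (int n) * z ^ n)"
  have c0: "Im (c 0) = 0" using herm[of 0] by (simp add: complex_eq_iff)
  have zz: "z * cnj z = 1" using z by (simp add: complex_norm_square[symmetric])
  have split: "{..N} = insert 0 {1..N}" by auto
  have "{..2 * N} = (\<lambda>n. N + n) ` {..N} \<union> (\<lambda>n. N - n) ` {1..N}"
  proof (intro equalityI subsetI)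
    fix i assume i: "i \<in> {..2 * N}"
    show "i \<in> (\<lambda>n. N + n) ` {..N} \<union> (\<lambda>n. N - n) ` {1..N}"
    proof (cases "N \<le> i")
      case True
      then have "i = N + (i - N)" "i - N \<in> {..N}" using i by auto
      then show ?thesis by blast
    next
      case False
      then have "i = N - (N - i)" "N - i \<in> {1..N}" by auto
      then show ?thesis by blast
    qed
  qed auto
  then have "(\<Sum>i\<le>2 * N. c (int i - int N) * z ^ i)
      = (\<Sum>i\<in>(\<lambda>n. N + n) ` {..N}. c (int i - int N) * z ^ i)
      + (\<Sum>i\<in>(\<lambda>n. N - n) ` {1..N}. c (int i - int N) * z ^ i)"
    by (simp only:) (rule sum.union_disjoint; auto)
  also have "\<dots> = (\<Sum>n\<le>N. c (int n) * z ^ (N + n)) + (\<Sum>n=1..N. c (- int n) * z ^ (N - n))"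
  proof -
    have "inj_on (\<lambda>n. N - n) {1..N}" by (auto simp: inj_on_def)
    then show ?thesis
      by (simp add: sum.reindex of_nat_diff)
  qed
  also have "\<dots> = (\<Sum>n\<le>N. z ^ N * (c (int n) * z ^ n)) + (\<Sum>n=1..N. z ^ N * cnj (c (int n) * z ^ n))"
  proof -
    have "z ^ (N - n) = z ^ N * cnj z ^ n" if "n \<le> N" for n
    proof -
      have "z ^ N * cnj z ^ n = z ^ (N - n) * (z * cnj z) ^ n"
        using that by (simp add: power_mult_distrib mult.assoc[symmetric] flip: power_add)
      then show ?thesis by (simp add: zz)
    qed
    then have "(\<Sum>n=1..N. c (- int n) * z ^ (N - n)) = (\<Sum>n=1..N. z ^ N * cnj (c (int n) * z ^ n))"
      by (intro sum.cong refl) (simp add: herm)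
    then show ?thesis by (simp add: power_add mult_ac)
  qed
  also have "\<dots> = z ^ N * (c 0 + A + cnj A)"
    unfolding split by (simp only: sum_distrib_left[symmetric] A_def cnj_sum) (simp add: algebra_simps sum_distrib_left[symmetric])
  also have "c 0 + A + cnj A = of_real (Re (c 0 + 2 * A))"
    using c0 by (simp add: complex_eq_iff)
  also have "c 0 + 2 * A = (\<Sum>i\<le>N. (if i = 0 then c 0 else 2 * c (int i)) * z ^ i)"
    unfolding split by (simp add: A_def sum_distrib_left mult.assoc)
  finally show ?thesis by (simp only: norm_mult norm_power z norm_of_real power_one mult_1)
qed

theorem hermitian_convolution_bound:
  fixes c :: "int \<Rightarrow> complex" and N :: nat
  assumes herm: "\<And>n. c (- n) = cnj (c n)" and supp: "\<And>n. \<bar>n\<bar> > int N \<Longrightarrow> c n = 0"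
  defines "S \<equiv> \<Sum>n\<in>{- int N..int N}. (cmod (c n))\<^sup>2"
    and "D \<equiv> \<Sum>n\<in>{- int N..int N}. real_of_int \<bar>n\<bar> * (cmod (c n))\<^sup>2"
  shows "(\<Sum>k\<in>{- 2 * int N..2 * int N}. (cmod (\<Sum>n\<in>{- int N..int N}. c n * c (k - n)))\<^sup>2)
    \<le> S\<^sup>2 + 4 * D * S + 8 * D\<^sup>2"
proof -
  \<comment> \<open>\<open>G * G\<close> and \<open>(P * P) * (P * P)\<close> have degree at most
    \<open>4 * N\<close>, so \<open>M\<close> sample points suffice for both.\<close>
  define M where "M = 4 * N + 1"
  define w where "w = cis (2 * pi / M)"
  define G where "G = Poly (map (\<lambda>i. c (int i - int N)) [0..<2 * N + 1])"
  define h where "h i = (if i = 0 then c 0 else 2 * c (int i))" for i :: nat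
  define P where "P = Poly (map h [0..<N + 1])"
  have cG: "coeff G i = c (int i - int N)" for i
  proof (cases "i < 2 * N + 1")
    case False
    then show ?thesis using supp[of "int i - int N"] by (simp add: G_def nth_default_def)
  qed (simp add: G_def nth_default_def del: upt_Suc)
  have cP: "coeff P i = h i" for i
  proof (cases "i < N + 1")
    case False
    then show ?thesis using supp[of "int i"] by (simp add: P_def nth_default_def h_def)
  qed (simp add: P_def nth_default_def del: upt_Suc)
  have dG: "degree G \<le> 2 * N" 
    by (rule degree_le) (use supp in \<open>auto simp: cG\<close>)
  have dP: "degree P \<le> N"
    by (rule degree_le) (use supp in \<open>auto simp: cP h_def\<close>)
  have wj: "cmod (w ^ j) = 1" for j by (simp add: w_def norm_power)
  have GP: "cmod (poly G z) = \<bar>Re (poly P z)\<bar>" if "cmod z = 1" for z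
  proof -
    have "poly G z = (\<Sum>i\<le>2 * N. c (int i - int N) * z ^ i)"
      using poly_sum_lessThan[of G "Suc (2 * N)" z] dG by (simp only: cG lessThan_Suc_atMost)
    moreover have "poly P z = (\<Sum>i\<le>N. h i * z ^ i)"
      using poly_sum_lessThan[of P "Suc N" z] dP by (simp only: cP lessThan_Suc_atMost)
    ultimately show ?thesis
      using hermitian_poly_eq_Re[of c z N] herm that by (simp add: h_def)
  qed
  have dGG: "degree (G * G) < M" using degree_mult_le[of G G] dG by (simp add: M_def)
  have dPP: "degree (P * P) \<le> 2 * N" using degree_mult_le[of P P] dP by simp
  then have dP4: "degree ((P * P) * (P * P)) < M"
    using degree_mult_le[of "P * P" "P * P"] by (simp add: M_def)
  have M0: "real M > 0" by (simp add: M_def)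

  define L where "L = (\<Sum>i<M. (cmod (coeff (G * G) i))\<^sup>2)"
  define U where "U = (\<Sum>i<M. (cmod (coeff P i))\<^sup>2)"
  define V where "V = (\<Sum>i<M. real i * (cmod (coeff P i))\<^sup>2)"
  define C where "C = (cmod (c 0))\<^sup>2"
  define K where "K = (\<Sum>n=1..N. (cmod (c (int n)))\<^sup>2)"
  define J where "J = (\<Sum>n=1..N. real n * (cmod (c (int n)))\<^sup>2)"
  \<comment> \<open>By Parseval \<open>L\<close> is the mean of \<open>(cmod G) ^ 4\<close>, and at
    the sample points \<open>G\<close> has the modulus of the real part of \<open>P\<close>.\<close>
  have "4 * (M * L) = (\<Sum>j<M. 4 * (Re (poly P (w ^ j))) ^ 4)"
  proof -
    have "(cmod (poly (G * G) (w ^ j)))\<^sup>2 = (Re (poly P (w ^ j))) ^ 4" for j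
      using GP[OF wj, of j] by (simp add: norm_mult power_mult_distrib flip: power_add)
    then have "M * L = (\<Sum>j<M. (Re (poly P (w ^ j))) ^ 4)"
      using poly_parseval[OF dGG] by (simp add: L_def w_def)
    then show ?thesis by (simp add: sum_distrib_left)
  qed
  also have "\<dots> \<le> (\<Sum>j<M. 3 * (cmod (poly P (w ^ j))) ^ 4 + Re ((poly P (w ^ j)) ^ 4))"
    by (intro sum_mono real_part_power4_le)
  also have "\<dots> = 3 * (\<Sum>j<M. (cmod (poly (P * P) (w ^ j)))\<^sup>2) + Re (\<Sum>j<M. poly ((P * P) * (P * P)) (w ^ j))"
    by (simp add: sum.distrib sum_distrib_left norm_mult power_mult_distrib eval_nat_numeral mult.assoc)
  \<comment> \<open>The mean of the analytic polynomial \<open>(P * P) * (P * P)\<close> is its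
    constant coefficient \<open>h 0 ^ 4\<close>.\<close>
  also have "\<dots> = M * (3 * (\<Sum>k<M. (cmod (coeff (P * P) k))\<^sup>2) + Re (h 0 ^ 4))"
  proof -
    have "degree (P * P) < M" using dPP by (simp add: M_def)
    moreover have "coeff ((P * P) * (P * P)) 0 = h 0 ^ 4"
      by (simp add: coeff_mult_0 cP eval_nat_numeral)
    ultimately show ?thesis
      using poly_mean_roots_of_unity[OF dP4] poly_parseval[of "P * P" M]
      by (simp add: w_def algebra_simps)
  qed
  also have "Re (h 0 ^ 4) \<le> C\<^sup>2"
    using complex_Re_le_cmod[of "h 0 ^ 4"] by (simp add: h_def C_def norm_power)
  also have "(\<Sum>k<M. (cmod (coeff (P * P) k))\<^sup>2) \<le> U * (U + 2 * V)"
    unfolding U_def V_def by (rule sum_coeff_square_le)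
  finally have "M * (4 * L) \<le> M * (3 * (U * (U + 2 * V)) + C\<^sup>2)" by (simp add: mult_left_mono)
  then have L: "4 * L \<le> 3 * (U * (U + 2 * V)) + C\<^sup>2" using M0 by simp
  \<comment> \<open>Doubling the coefficients at positive indices multiplies their squares by four;
    those beyond \<open>N\<close> vanish.\<close>
  have PM: "(\<Sum>i<M. g i * (cmod (coeff P i))\<^sup>2) = g 0 * C + (\<Sum>n=1..N. 4 * (g n * (cmod (c (int n)))\<^sup>2))" for g :: "nat \<Rightarrow> real"
  proof -
    have "(\<Sum>i<M. g i * (cmod (coeff P i))\<^sup>2) = (\<Sum>i\<in>insert 0 {1..N}. g i * (cmod (coeff P i))\<^sup>2)"
      using supp by (intro sum.mono_neutral_right) (auto simp: cP h_def M_def)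
    also have "\<dots> = g 0 * C + (\<Sum>n=1..N. 4 * (g n * (cmod (c (int n)))\<^sup>2))"
      by (subst sum.insert) (auto intro!: sum.cong simp: cP h_def C_def norm_mult power_mult_distrib)
    finally show ?thesis .
  qed
  have U: "U = C + 4 * K" using PM[of "\<lambda>_. 1"] by (simp add: U_def K_def sum_distrib_left)
  have V: "V = 4 * J" using PM[of real] by (simp add: V_def J_def sum_distrib_left)
  have S: "S = C + 2 * K"
    unfolding S_def sum_int_symmetric by (simp add: C_def K_def herm sum_distrib_left)
  have D: "D = 2 * J"
    unfolding D_def sum_int_symmetric by (simp add: J_def herm sum_distrib_left)
  have "0 \<le> C" "0 \<le> K" by (auto simp: C_def K_def intro!: sum_nonneg)
  have KJ: "K \<le> J" unfolding K_def J_def by (intro sum_mono) (simp add: mult_le_cancel_right1)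
  \<comment> \<open>This combination, nonnegative by \<open>K \<le> J\<close>, is exactly the
    difference of the two sides of the next inequality.\<close>
  have "0 \<le> 8 * (C * (J - K)) + 32 * ((J - K) * (J + K)) + 32 * (J * (J - K)) + 64 * (J * J)"
    using KJ \<open>0 \<le> C\<close> \<open>0 \<le> K\<close> by (intro add_nonneg_nonneg mult_nonneg_nonneg) auto
  then have "3 * (U * (U + 2 * V)) + C\<^sup>2 \<le> 4 * (S\<^sup>2 + 4 * D * S + 8 * D\<^sup>2)"
    unfolding U V S D by (simp add: power2_eq_square algebra_simps)
  from order_trans[OF L this] have "L \<le> S\<^sup>2 + 4 * D * S + 8 * D\<^sup>2" by simp
  moreover have "(\<Sum>k\<in>{- 2 * int N..2 * int N}. (cmod (\<Sum>n\<in>{- int N..int N}. c n * c (k - n)))\<^sup>2) = L"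
  proof -
    \<comment> \<open>\<open>G\<close> carries index \<open>n\<close> at exponent
      \<open>n + N\<close>, so its square carries index \<open>k\<close> at exponent
      \<open>k + 2 * N\<close>. Terms outside the window vanish, which lets the range be extended
      and then cut.\<close>
    have conv: "coeff (G * G) i = (\<Sum>n\<in>{- int N..int N}. c n * c ((int i - 2 * int N) - n))" for i
    proof -
      have "coeff (G * G) i = (\<Sum>j\<le>i. c (int j - int N) * c (int (i - j) - int N))"
        by (simp add: coeff_mult cG)
      also have "\<dots> = (\<Sum>j\<le>i. c (int j - int N) * c (int i - int j - int N))"
        by (intro sum.cong refl) (simp add: of_nat_diff)
      also have "\<dots> = (\<Sum>j\<le>i + 2 * N. c (int j - int N) * c (int i - int j - int N))"
        using supp by (intro sum.mono_neutral_left) auto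
      also have "\<dots> = (\<Sum>j\<le>2 * N. c (int j - int N) * c (int i - int j - int N))"
        using supp by (intro sum.mono_neutral_right) auto
      also have "\<dots> = (\<Sum>n\<in>{- int N..int N}. c n * c ((int i - 2 * int N) - n))"
        by (rule sum.reindex_bij_witness[of _ "\<lambda>n. nat (n + int N)" "\<lambda>j. int j - int N"])
           (auto simp: algebra_simps)
      finally show ?thesis .
    qed
    show ?thesis unfolding L_def conv
      by (rule sum.reindex_bij_witness[of _ "\<lambda>i. int i - 2 * int N" "\<lambda>k. nat (k + 2 * int N)"])
         (auto simp: M_def)
  qed
  ultimately show ?thesis by simp
qed

section \<open>The rotation algebra as operators\<close>

lemma real_poly_approximation:
  fixes \<phi> :: "real \<Rightarrow> real"
  assumes "compact S" "continuous_on S \<phi>" "0 < e"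
  obtains p where "\<And>t. t \<in> S \<Longrightarrow> \<bar>\<phi> t - poly p t\<bar> \<le> e"
proof -
  obtain g where g: "real_polynomial_function g" "\<And>x. x \<in> S \<Longrightarrow> \<bar>\<phi> x - g x\<bar> < e"
    using Stone_Weierstrass_real_polynomial_function[OF assms] by blast
  obtain a n where "g = (\<lambda>x. \<Sum>i\<le>n. a i * x ^ i)"
    using g(1) unfolding real_polynomial_function_iff_sum by blast
  then have "g = poly (\<Sum>i\<le>n. monom (a i) i)"
    by (simp add: fun_eq_iff poly_sum poly_monom)
  then show thesis using g(2) that less_imp_le by metis
qed

text \<open>The pairing is bilinear, without conjugation, as in a convolution. Passing to the
  vectors of moduli bounds it by a real inner product, to which Cauchy-Schwarz applies.\<close>

lemma ell2_mult_summable: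
  fixes x y :: "'i ell2"
  shows "(\<lambda>i. norm (coord x i * coord y i)) summable_on UNIV"
    and "cmod (\<Sum>\<^sub>\<infinity>i. coord x i * coord y i) \<le> norm x * norm y"
proof -
  define ab :: "'i ell2 \<Rightarrow> 'i ell2" where "ab z = Ell2 (\<lambda>i. of_real (cmod (coord z i)))" for z
  have cab: "coord (ab z) i = of_real (cmod (coord z i))" for z i
    unfolding ab_def
    by (subst coord_Ell2) (auto intro: square_summable_mono[OF square_summable_coord[of z]])
  have nab: "norm (ab z) = norm z" for z
    by (rule power2_eq_imp_eq) (simp_all add: norm_ell2_sq cab)
  have hs: "((\<lambda>i. norm (coord x i * coord y i)) has_sum ab x \<bullet> ab y) UNIV"
    using inner_ell2_has_sum[of "ab x" "ab y"] by (simp add: cab norm_mult inner_complex_def)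
  then show abs: "(\<lambda>i. norm (coord x i * coord y i)) summable_on UNIV"
    by (rule has_sum_imp_summable)
  have "cmod (\<Sum>\<^sub>\<infinity>i. coord x i * coord y i) \<le> (\<Sum>\<^sub>\<infinity>i. norm (coord x i * coord y i))"
    by (rule norm_infsum_bound[OF abs])
  also have "\<dots> = ab x \<bullet> ab y" by (rule infsumI[OF hs])
  also have "\<dots> \<le> norm x * norm y" using norm_cauchy_schwarz[of "ab x" "ab y"] by (simp add: nab)
  finally show "cmod (\<Sum>\<^sub>\<infinity>i. coord x i * coord y i) \<le> norm x * norm y" .
qed

section \<open>The twisting phase and twisted convolution\<close>

lemma rot_add: "rot \<theta> (k + l) = rot \<theta> k * rot \<theta> l"
  by (simp add: rot_def cis_mult algebra_simps)

lemma cmod_rot [simp]: "cmod (rot \<theta> k) = 1"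
  by (simp add: rot_def)

lemma rot_0 [simp]: "rot \<theta> 0 = 1"
  by (simp add: rot_def)

lemma cnj_rot: "cnj (rot \<theta> k) = rot \<theta> (- k)"
  by (simp add: rot_def cis_cnj)

text \<open>The phase from moving the power \<open>snd p\<close> of \<open>V\<close> past the power
  \<open>fst x\<close> of \<open>U\<close>. It is a bicharacter, and this property replaces the
  explicit exponent in most computations below.\<close>

definition cocycle :: "real \<Rightarrow> int \<times> int \<Rightarrow> int \<times> int \<Rightarrow> complex" where
  "cocycle \<theta> p x = rot \<theta> (- (snd p * fst x))"

lemma cocycle_simps:
  "cocycle \<theta> (p + q) x = cocycle \<theta> p x * cocycle \<theta> q x"
  "cocycle \<theta> p (x + y) = cocycle \<theta> p x * cocycle \<theta> p y"
  "cocycle \<theta> 0 x = 1" "cmod (cocycle \<theta> p x) = 1"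
  by (simp_all add: cocycle_def algebra_simps flip: rot_add)

lemma tw_mult_eq: "tw_mult \<theta> f g x = (\<Sum>\<^sub>\<infinity>p. f p * (g (x - p) * cocycle \<theta> p (x - p)))"
  unfolding tw_mult_def cocycle_def by (cases x) (auto intro!: infsum_cong simp: mult.assoc)

type_synonym hilb = "(int \<times> int) ell2"

abbreviation vac :: hilb where "vac \<equiv> basis 0 1"

lemma coord_vac: "coord vac = one_c"
  by (simp add: fun_eq_iff one_c_def zero_prod_def)

text \<open>The reflection of \<open>g\<close> that absorbs the phase, so that the coefficient of
  the twisted product at \<open>x\<close> is a bilinear pairing of \<open>f\<close> with it. Being
  isometric in \<open>g\<close>, it makes each such coefficient continuous.\<close>

definition twist :: "real \<Rightarrow> int \<times> int \<Rightarrow> hilb \<Rightarrow> hilb" where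
  "twist \<theta> x g = Ell2 (\<lambda>p. coord g (x - p) * cocycle \<theta> p (x - p))"

lemma reflect_has_sum:
  fixes f :: "int \<times> int \<Rightarrow> real"
  shows "((\<lambda>p. f (x - p)) has_sum s) UNIV \<longleftrightarrow> (f has_sum s) UNIV"
  by (rule has_sum_reindex_bij_witness[of _ "\<lambda>p. x - p" "\<lambda>p. x - p"]) auto

lemma norm_sq_has_sum: "((\<lambda>i. (cmod (coord x i))\<^sup>2) has_sum (norm x)\<^sup>2) UNIV"
  using inner_ell2_has_sum[of x x] by (simp add: power2_norm_eq_inner)

lemma
  shows coord_twist: "coord (twist \<theta> x g) p = coord g (x - p) * cocycle \<theta> p (x - p)"
    and norm_twist: "norm (twist \<theta> x g) = norm g"
proof -
  have hs: "((\<lambda>p. (cmod (coord g (x - p) * cocycle \<theta> p (x - p)))\<^sup>2) has_sum (norm g)\<^sup>2) UNIV"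
    using reflect_has_sum[of "\<lambda>p. (cmod (coord g p))\<^sup>2" x] norm_sq_has_sum[of g]
    by (simp add: norm_mult cocycle_simps)
  then have ss: "square_summable (\<lambda>p. coord g (x - p) * cocycle \<theta> p (x - p))"
    unfolding square_summable_def by (rule has_sum_imp_summable)
  show "coord (twist \<theta> x g) p = coord g (x - p) * cocycle \<theta> p (x - p)"
    by (simp add: twist_def coord_Ell2 ss)
  have "(norm (twist \<theta> x g))\<^sup>2 = (norm g)\<^sup>2"
    using infsumI[OF hs] by (simp only: norm_ell2_sq twist_def coord_Ell2[OF ss])
  then show "norm (twist \<theta> x g) = norm g" by simp
qed

lemma tw_mult_twist:
  "tw_mult \<theta> (coord f) (coord g) x = (\<Sum>\<^sub>\<infinity>p. coord f p * coord (twist \<theta> x g) p)"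
  by (simp add: tw_mult_eq coord_twist)

text \<open>Continuity is claimed for each coefficient separately, since for general
  \<open>f\<close> the product may fail to be square-summable.\<close>

lemma bounded_linear_tw_mult: "bounded_linear (\<lambda>g. tw_mult \<theta> (coord f) (coord g) x)"
proof (rule bounded_linear_intro)
  note sum = abs_summable_summable[OF ell2_mult_summable(1)]
  fix g h :: hilb and r :: real
  have "tw_mult \<theta> (coord f) (coord (g + h)) x
    = (\<Sum>\<^sub>\<infinity>p. coord f p * coord (twist \<theta> x g) p + coord f p * coord (twist \<theta> x h) p)"
    unfolding tw_mult_twist by (rule infsum_cong) (simp add: coord_twist algebra_simps)
  also have "\<dots> = tw_mult \<theta> (coord f) (coord g) x + tw_mult \<theta> (coord f) (coord h) x"
    unfolding tw_mult_twist by (rule infsum_add[OF sum sum])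
  finally show "tw_mult \<theta> (coord f) (coord (g + h)) x
    = tw_mult \<theta> (coord f) (coord g) x + tw_mult \<theta> (coord f) (coord h) x" .
  have "tw_mult \<theta> (coord f) (coord (r *\<^sub>R g)) x = (\<Sum>\<^sub>\<infinity>p. r *\<^sub>R (coord f p * coord (twist \<theta> x g) p))"
    unfolding tw_mult_twist
    by (rule infsum_cong) (simp add: coord_twist scaleR_conv_of_real algebra_simps)
  then show "tw_mult \<theta> (coord f) (coord (r *\<^sub>R g)) x = r *\<^sub>R tw_mult \<theta> (coord f) (coord g) x"
    unfolding tw_mult_twist by (simp add: infsum_scaleR_right)
  show "norm (tw_mult \<theta> (coord f) (coord g) x) \<le> norm g * norm f"
    unfolding tw_mult_twist using ell2_mult_summable(2)[of f "twist \<theta> x g"]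
    by (simp add: norm_twist mult.commute)
qed

lemmas linear_tw_mult =
  linear_add[OF bounded_linear.linear[OF bounded_linear_tw_mult]]
  linear_scale[OF bounded_linear.linear[OF bounded_linear_tw_mult]]

text \<open>Right multiplication by the monomial with coefficient \<open>c\<close> at
  \<open>k\<close>. For \<open>k = 0\<close> it is multiplication by a complex scalar, so commuting
  with all of these includes complex linearity.\<close>

definition rmult :: "real \<Rightarrow> int \<times> int \<Rightarrow> complex \<Rightarrow> hilb \<Rightarrow> hilb" where
  "rmult \<theta> k c f = Ell2 (\<lambda>x. coord f (x - k) * (c * cocycle \<theta> (x - k) k))"

lemma shift_has_sum:
  fixes f :: "int \<times> int \<Rightarrow> real"
  shows "((\<lambda>p. f (p - k)) has_sum s) UNIV \<longleftrightarrow> (f has_sum s) UNIV"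
  by (rule has_sum_reindex_bij_witness[of _ "\<lambda>p. p + k" "\<lambda>p. p - k"]) auto

lemma
  shows coord_rmult: "coord (rmult \<theta> k c f) x = coord f (x - k) * (c * cocycle \<theta> (x - k) k)"
    and norm_rmult: "norm (rmult \<theta> k c f) = norm f * cmod c"
proof -
  have hs: "((\<lambda>x. (cmod (coord f (x - k) * (c * cocycle \<theta> (x - k) k)))\<^sup>2) has_sum (norm f * cmod c)\<^sup>2) UNIV"
    using has_sum_cmult_left[OF norm_sq_has_sum[of f], of "(cmod c)\<^sup>2"]
      shift_has_sum[of "\<lambda>p. (cmod (coord f p))\<^sup>2 * (cmod c)\<^sup>2" k]
    by (simp add: norm_mult cocycle_simps power_mult_distrib)
  then have ss: "square_summable (\<lambda>x. coord f (x - k) * (c * cocycle \<theta> (x - k) k))"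
    unfolding square_summable_def by (rule has_sum_imp_summable)
  show "coord (rmult \<theta> k c f) x = coord f (x - k) * (c * cocycle \<theta> (x - k) k)"
    by (simp add: rmult_def coord_Ell2 ss)
  have "(norm (rmult \<theta> k c f))\<^sup>2 = (norm f * cmod c)\<^sup>2"
    using infsumI[OF hs] by (simp only: norm_ell2_sq[of "Ell2 _"] rmult_def coord_Ell2[OF ss])
  then show "norm (rmult \<theta> k c f) = norm f * cmod c" by (rule power2_eq_imp_eq) auto
qed

lemma bounded_linear_rmult: "bounded_linear (rmult \<theta> k c)"
  by (rule bounded_linear_intro[of _ "cmod c"])
    (auto intro!: ell2_eqI simp: coord_rmult norm_rmult algebra_simps)

lemmas linear_rmult =
  linear_add[OF bounded_linear.linear[OF bounded_linear_rmult]]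
  linear_diff[OF bounded_linear.linear[OF bounded_linear_rmult]]
  linear_scale[OF bounded_linear.linear[OF bounded_linear_rmult]]

lemma rmult_basis: "rmult \<theta> k c (basis j d) = basis (j + k) (d * c * cocycle \<theta> j k)"
  by (rule ell2_eqI) (auto simp: coord_rmult algebra_simps)

lemma rmult_vac: "rmult \<theta> k c vac = basis k c"
  by (simp add: rmult_basis cocycle_simps)

lemma rmult_rmult: "rmult \<theta> k c (rmult \<theta> j d f) = rmult \<theta> (j + k) (d * c * cocycle \<theta> j k) f"
proof (rule ell2_eqI)
  fix x
  have "x - k = (x - k - j) + j" by simp
  then have "cocycle \<theta> (x - k) k = cocycle \<theta> (x - k - j) k * cocycle \<theta> j k"
    by (metis cocycle_simps(1))
  then show "coord (rmult \<theta> k c (rmult \<theta> j d f)) x = coord (rmult \<theta> (j + k) (d * c * cocycle \<theta> j k) f) x"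
    by (simp add: coord_rmult cocycle_simps algebra_simps)
qed

lemma tw_mult_basis: "tw_mult \<theta> (coord f) (coord (basis k c)) = coord (rmult \<theta> k c f)"
proof
  fix x
  have "tw_mult \<theta> (coord f) (coord (basis k c)) x
      = (\<Sum>\<^sub>\<infinity>p\<in>{x - k}. coord f p * (coord (basis k c) (x - p) * cocycle \<theta> p (x - p)))"
    unfolding tw_mult_eq by (rule infsum_cong_neutral) (auto simp: algebra_simps)
  then show "tw_mult \<theta> (coord f) (coord (basis k c)) x = coord (rmult \<theta> k c f) x"
    by (simp add: coord_rmult)
qed

text \<open>The commutant of the right regular representation; its elements act as left twisted
  convolution by the image of the vacuum vector.\<close>

definition right_module_ops :: "real \<Rightarrow> (hilb \<Rightarrow>\<^sub>L hilb) set" where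
  "right_module_ops \<theta> = {S :: hilb \<Rightarrow>\<^sub>L hilb. \<forall>k c f. S (rmult \<theta> k c f) = rmult \<theta> k c (S f)}"

lemma right_module_opsD: "S \<in> right_module_ops \<theta> \<Longrightarrow> S (rmult \<theta> k c f) = rmult \<theta> k c (S f)"
  unfolding right_module_ops_def by blast

lemma right_module_ops_basis:
  assumes "S \<in> right_module_ops \<theta>"
  shows "S (basis k c) = rmult \<theta> k c (S vac)"
  by (metis assms right_module_opsD rmult_vac)

text \<open>Right multiplication by monomials carries \<open>vac\<close> to all basis vectors, so an
  operator commuting with it is determined by its value at \<open>vac\<close>.\<close>

lemma right_module_ops_eqI:
  assumes "S \<in> right_module_ops \<theta>" "S' \<in> right_module_ops \<theta>" "S vac = S' vac"
  shows "S = S'"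
proof -
  have "blinfun_apply S = blinfun_apply S'"
  proof (rule bounded_linear_eqI_basis)
    show "S (basis k c) = S' (basis k c)" for k c
      using right_module_ops_basis[OF assms(1), of k c] right_module_ops_basis[OF assms(2), of k c] assms(3)
      by simp
  qed (rule blinfun.bounded_linear_right)+
  then show ?thesis by (simp add: blinfun_apply_inject)
qed

text \<open>Both sides are bounded linear in \<open>g\<close> in each coefficient, and on basis
  vectors both are right multiples of \<open>S vac\<close>.\<close>

lemma tw_mult_right_module_ops:
  assumes "S \<in> right_module_ops \<theta>"
  shows "tw_mult \<theta> (coord (S vac)) (coord g) = coord (S g)"
proof
  fix x
  have "(\<lambda>g. tw_mult \<theta> (coord (S vac)) (coord g) x) = (\<lambda>g. coord (S g) x)"
  proof (rule bounded_linear_eqI_basis)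
    show "bounded_linear (\<lambda>g. coord (S g) x)"
      by (rule bounded_linear_compose[OF bounded_linear_coord blinfun.bounded_linear_right])
    show "tw_mult \<theta> (coord (S vac)) (coord (basis k c)) x = coord (S (basis k c)) x" for k c
      using right_module_ops_basis[OF assms, of k c] by (simp add: tw_mult_basis)
  qed (rule bounded_linear_tw_mult)
  then show "tw_mult \<theta> (coord (S vac)) (coord g) x = coord (S g) x" by meson
qed

lemma right_module_ops_linear:
  assumes "S \<in> right_module_ops \<theta>" "S' \<in> right_module_ops \<theta>"
  shows "S + S' \<in> right_module_ops \<theta>" "S - S' \<in> right_module_ops \<theta>" "r *\<^sub>R S \<in> right_module_ops \<theta>"
    "S o\<^sub>L S' \<in> right_module_ops \<theta>"
  using assms unfolding right_module_ops_def
  by (simp_all add: blinfun.bilinear_simps linear_rmult del: split_paired_All)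

lemma id_right_module_ops: "id_blinfun \<in> right_module_ops \<theta>"
  by (simp add: right_module_ops_def)

lemma closed_right_module_ops: "closed (right_module_ops \<theta>)"
proof -
  have "closed {S. blinfun_apply S (rmult \<theta> k c f) = rmult \<theta> k c (S f)}" for k c f
    by (intro closed_Collect_eq continuous_intros
        bounded_linear.continuous_on[OF bounded_linear_rmult])
  then show ?thesis
    unfolding right_module_ops_def by (intro closed_Collect_all)
qed

section \<open>Operator norms of left multiplications\<close>

lemma l2norm_coord: "l2norm (coord x) = norm x"
  by (simp add: l2norm_def flip: norm_ell2_sq)

text \<open>\<open>L\<close> is compared with the product on finitely supported vectors alone, so
  that it may be an operator whose boundedness is still to be shown.\<close>

lemma op_norm_set_coord:
  assumes "\<And>g. finite {x. coord g x \<noteq> 0} \<Longrightarrow> tw_mult \<theta> (coord f) (coord g) = coord (L g)"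
  shows "op_norm_set \<theta> (coord f) = {norm (L g) | g. finite {x. coord g x \<noteq> 0} \<and> norm g \<le> 1}"
proof (intro equalityI subsetI)
  fix r assume "r \<in> op_norm_set \<theta> (coord f)"
  then obtain g where g: "finite {x. g x \<noteq> 0}" "l2norm g \<le> 1" "r = l2norm (tw_mult \<theta> (coord f) g)"
    unfolding op_norm_set_def by blast
  moreover from g(1) have "coord (Ell2 g) = g" by (simp add: coord_Ell2 square_summable_finite)
  ultimately show "r \<in> {norm (L g) | g. finite {x. coord g x \<noteq> 0} \<and> norm g \<le> 1}"
    using assms[of "Ell2 g"] by (auto simp flip: l2norm_coord intro!: exI[of _ "Ell2 g"])
next
  fix r assume "r \<in> {norm (L g) | g. finite {x. coord g x \<noteq> 0} \<and> norm g \<le> 1}"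
  then obtain g where g: "finite {x. coord g x \<noteq> 0}" "norm g \<le> 1" "r = norm (L g)" by blast
  then show "r \<in> op_norm_set \<theta> (coord f)"
    unfolding op_norm_set_def
    by (intro CollectI exI[of _ "coord g"]) (simp add: assms l2norm_coord)
qed

lemma finite_support_scale:
  fixes L :: "'i ell2 \<Rightarrow> 'b::real_normed_vector"
  assumes L: "\<And>r g. finite {x. coord g x \<noteq> 0} \<Longrightarrow> L (r *\<^sub>R g) = r *\<^sub>R L g"
    and C: "\<And>g. finite {x. coord g x \<noteq> 0} \<Longrightarrow> norm g \<le> 1 \<Longrightarrow> norm (L g) \<le> C"
    and g: "finite {x. coord g x \<noteq> 0}"
  shows "norm (L g) \<le> C * norm g"
proof (cases "g = 0")
  case True
  then show ?thesis using L[of g 0] g by simp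
next
  case False
  have "finite {x. coord (g /\<^sub>R norm g) x \<noteq> 0}" using g False by simp
  then have "norm (L (g /\<^sub>R norm g)) \<le> C" using False by (intro C) auto
  then show ?thesis using False by (simp add: L[OF g] pos_divide_le_eq divide_inverse_commute[symmetric])
qed

text \<open>Finitely supported vectors are dense, so testing on them already gives the full operator
  norm.\<close>

lemma op_norm_right_module_ops:
  assumes S: "S \<in> right_module_ops \<theta>"
  shows "bdd_above (op_norm_set \<theta> (coord (S vac)))" "op_norm \<theta> (coord (S vac)) = norm S"
proof -
  have eq: "op_norm_set \<theta> (coord (S vac)) = {norm (S g) | g. finite {x. coord g x \<noteq> 0} \<and> norm g \<le> 1}"
    by (rule op_norm_set_coord) (rule tw_mult_right_module_ops[OF S])
  have le: "r \<le> norm S" if "r \<in> op_norm_set \<theta> (coord (S vac))" for r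
  proof -
    obtain g where g: "r = norm (S g)" "norm g \<le> 1" using \<open>r \<in> _\<close> unfolding eq by blast
    have "norm (S g) \<le> norm S * norm g" by (rule norm_blinfun)
    also have "\<dots> \<le> norm S * 1" using g by (intro mult_left_mono) auto
    finally show ?thesis using g by simp
  qed
  then show bdd: "bdd_above (op_norm_set \<theta> (coord (S vac)))" by (rule bdd_aboveI)
  show "op_norm \<theta> (coord (S vac)) = norm S"
  proof (rule antisym)
    have ne: "norm (S 0) \<in> op_norm_set \<theta> (coord (S vac))"
      unfolding eq by (intro CollectI exI[of _ 0]) simp
    then show "op_norm \<theta> (coord (S vac)) \<le> norm S"
      unfolding op_norm_def using le by (intro cSup_least) auto
    have nn: "0 \<le> op_norm \<theta> (coord (S vac))"
      unfolding op_norm_def using cSup_upper[OF ne bdd] by simp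
    show "norm S \<le> op_norm \<theta> (coord (S vac))"
    proof (rule norm_blinfun_bound[OF nn])
      fix g
      have "closed {g. norm (S g) \<le> op_norm \<theta> (coord (S vac)) * norm g}"
        by (intro closed_Collect_le continuous_intros)
      moreover have "{g. finite {x. coord g x \<noteq> 0}} \<subseteq> {g. norm (S g) \<le> op_norm \<theta> (coord (S vac)) * norm g}"
      proof (intro subsetI CollectI)
        fix g :: hilb assume "g \<in> {g. finite {x. coord g x \<noteq> 0}}"
        then show "norm (S g) \<le> op_norm \<theta> (coord (S vac)) * norm g"
          by (intro finite_support_scale[of "blinfun_apply S"])
            (auto simp: blinfun.bilinear_simps op_norm_def eq intro!: cSup_upper bdd[unfolded eq])
      qed
      ultimately show "norm (S g) \<le> op_norm \<theta> (coord (S vac)) * norm g"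
        using closure_minimal closure_finite_support by blast
    qed
  qed
qed

lemma tw_mult_finite_support:
  assumes "finite {x. coord g x \<noteq> 0}"
  shows "tw_mult \<theta> (coord f) (coord g) = coord (\<Sum>k | coord g k \<noteq> 0. rmult \<theta> k (coord g k) f)"
proof
  fix x
  interpret bounded_linear "\<lambda>g. tw_mult \<theta> (coord f) (coord g) x" by (rule bounded_linear_tw_mult)
  have "g = (\<Sum>k | coord g k \<noteq> 0. basis k (coord g k))"
    by (rule finite_support_eq_sum_basis[OF assms]) simp
  then have "tw_mult \<theta> (coord f) (coord g) x = (\<Sum>k | coord g k \<noteq> 0. tw_mult \<theta> (coord f) (coord (basis k (coord g k))) x)"
    using sum by metis
  then show "tw_mult \<theta> (coord f) (coord g) x = coord (\<Sum>k | coord g k \<noteq> 0. rmult \<theta> k (coord g k) f) x"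
    by (simp add: tw_mult_basis coord_sum)
qed

text \<open>A bound on finitely supported vectors extends to the whole space: the products with
  approximants \<open>G n\<close> are bounded in norm and converge in each coefficient, so by Fatou
  the product with any \<open>g\<close> is square-summable with the same bound.\<close>

lemma right_module_op_exists:
  assumes bdd: "bdd_above (op_norm_set \<theta> (coord f))"
  obtains S where "S \<in> right_module_ops \<theta>" "S vac = f"
proof -
  define F :: "hilb set" where "F = {g. finite {x. coord g x \<noteq> 0}}"
  \<comment> \<open>\<open>Ell2\<close> is meaningful only on square-summable families; for
    \<open>g\<close> in \<open>F\<close> this is immediate, and for all \<open>g\<close> it is part
    of \<open>main\<close>.\<close>
  define L where "L g = Ell2 (tw_mult \<theta> (coord f) (coord g))" for g
  have LF: "tw_mult \<theta> (coord f) (coord g) = coord (L g)" if "g \<in> F" for g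
    using tw_mult_finite_support[of g] that by (simp add: L_def F_def coord_inverse)
  obtain C where C: "\<And>r. r \<in> op_norm_set \<theta> (coord f) \<Longrightarrow> r \<le> C"
    using bdd by (auto simp: bdd_above_def)
  have C1: "norm (L g) \<le> C" if "g \<in> F" "norm g \<le> 1" for g
    using C op_norm_set_coord[of \<theta> f L] LF that unfolding F_def by blast
  have scale: "L (r *\<^sub>R g) = r *\<^sub>R L g" if "g \<in> F" for r g
  proof (rule ell2_eqI)
    have "r *\<^sub>R g \<in> F" using that by (auto simp: F_def elim: rev_finite_subset)
    then show "coord (L (r *\<^sub>R g)) x = coord (r *\<^sub>R L g) x" for x
      using linear_tw_mult(2)[of \<theta> f r g x]
      by (simp add: LF[symmetric] that scaleR_conv_of_real)
  qed
  have CF: "norm (L g) \<le> C * norm g" if "g \<in> F" for g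
    by (rule finite_support_scale[of L]) (use scale C1 that in \<open>auto simp: F_def\<close>)
  have "norm (L 0) \<le> C" by (rule C1) (simp_all add: F_def)
  then have "0 \<le> C" using norm_ge_zero[of "L 0"] by linarith
  have main: "square_summable (tw_mult \<theta> (coord f) (coord g)) \<and> norm (L g) \<le> C * norm g" for g
  proof -
    have "g \<in> closure F" by (simp add: F_def closure_finite_support)
    then obtain G where G: "\<And>n. G n \<in> F" "G \<longlonglongrightarrow> g" unfolding closure_sequential by blast
    have lim: "(\<lambda>n. coord (L (G n)) x) \<longlonglongrightarrow> tw_mult \<theta> (coord f) (coord g) x" for x
      using bounded_linear.tendsto[OF bounded_linear_tw_mult G(2)] by (simp add: LF[OF G(1), symmetric])
    \<comment> \<open>The slack \<open>e\<close> allows for approximants slightly longer than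
      \<open>g\<close>; it is sent to zero afterwards.\<close>
    have ev: "\<forall>\<^sub>F n in sequentially. norm (L (G n)) \<le> C * (norm g + e)" if "e > 0" for e
    proof -
      have "\<forall>\<^sub>F n in sequentially. norm (G n) < norm g + e"
        using tendsto_norm[OF G(2)] by (rule order_tendstoD(2)) (use that in simp)
      then show ?thesis
      proof eventually_elim
        case (elim n)
        have "norm (L (G n)) \<le> C * norm (G n)" by (rule CF[OF G(1)])
        also have "\<dots> \<le> C * (norm g + e)" using elim \<open>0 \<le> C\<close> by (intro mult_left_mono) auto
        finally show ?case .
      qed
    qed
    have "norm (L g) \<le> C * norm g"
    proof (rule tendsto_lowerbound)
      show "((\<lambda>e. C * (norm g + e)) \<longlongrightarrow> C * norm g) (at_right 0)"
        by (rule tendsto_eq_intros refl | simp)+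
      show "\<forall>\<^sub>F e in at_right 0. norm (L g) \<le> C * (norm g + e)"
        using square_summable_Fatou(2)[OF lim ev]
        by (auto simp: eventually_at_right_field L_def intro!: exI[of _ 1])
    qed simp
    then show ?thesis using square_summable_Fatou(1)[OF lim ev[of 1]] by simp
  qed
  have cL: "coord (L g) = tw_mult \<theta> (coord f) (coord g)" for g
    using main by (simp add: L_def coord_Ell2)
  have bl: "bounded_linear L"
  proof (rule bounded_linear_intro)
    show "L (g + h) = L g + L h" for g h
      by (rule ell2_eqI) (simp add: cL linear_tw_mult)
    show "L (r *\<^sub>R g) = r *\<^sub>R L g" for r g
      by (rule ell2_eqI) (simp add: cL linear_tw_mult scaleR_conv_of_real)
    show "norm (L g) \<le> norm g * C" for g using main[of g] by (simp add: mult.commute)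
  qed
  have Lb: "L (basis k c) = rmult \<theta> k c f" for k c
    by (rule ell2_eqI) (simp add: cL tw_mult_basis)
  have "(\<lambda>g. L (rmult \<theta> k c g)) = (\<lambda>g. rmult \<theta> k c (L g))" for k c
    by (rule bounded_linear_eqI_basis)
      (simp_all add: bounded_linear_compose[OF bl bounded_linear_rmult]
        bounded_linear_compose[OF bounded_linear_rmult bl] Lb rmult_basis rmult_rmult)
  then have "Blinfun L \<in> right_module_ops \<theta>"
    by (simp add: right_module_ops_def bounded_linear_Blinfun_apply[OF bl] fun_eq_iff)
  moreover have "Blinfun L vac = f"
    by (rule ell2_eqI) (simp add: bounded_linear_Blinfun_apply[OF bl] Lb coord_rmult cocycle_def)
  ultimately show thesis using that by blast
qed

section \<open>The algebra as a norm closure\<close>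

definition finite_ops :: "real \<Rightarrow> (hilb \<Rightarrow>\<^sub>L hilb) set" where
  "finite_ops \<theta> = {S \<in> right_module_ops \<theta>. finite {x. coord (S vac) x \<noteq> 0}}"

definition rot_algebra :: "real \<Rightarrow> (hilb \<Rightarrow>\<^sub>L hilb) set" where
  "rot_algebra \<theta> = closure (finite_ops \<theta>)"

text \<open>The support of a product lies in the sum set of the supports.\<close>

lemma finite_ops_compose:
  assumes S: "S \<in> finite_ops \<theta>" "S' \<in> finite_ops \<theta>"
  shows "S o\<^sub>L S' \<in> finite_ops \<theta>"
proof -
  define K where "K = {k. coord (S' vac) k \<noteq> 0}"
  define J where "J = {k. coord (S vac) k \<noteq> 0}"
  have K: "finite K" and J: "finite J" and R: "S \<in> right_module_ops \<theta>" "S' \<in> right_module_ops \<theta>"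
    using S by (auto simp: finite_ops_def K_def J_def)
  have "S' vac = (\<Sum>k\<in>K. basis k (coord (S' vac) k))"
    by (rule finite_support_eq_sum_basis[OF K]) (simp add: K_def)
  then have "S (S' vac) = (\<Sum>k\<in>K. rmult \<theta> k (coord (S' vac) k) (S vac))"
    using right_module_ops_basis[OF R(1)] by (metis (no_types, lifting) blinfun.sum_right sum.cong)
  then have "{x. coord (S (S' vac)) x \<noteq> 0} \<subseteq> (\<Union>k\<in>K. (\<lambda>j. j + k) ` J)"
  proof (clarsimp simp del: split_paired_All split_paired_Ex)
    fix x assume eq: "S (S' vac) = (\<Sum>k\<in>K. rmult \<theta> k (coord (S' vac) k) (S vac))"
      and "coord (\<Sum>k\<in>K. rmult \<theta> k (coord (S' vac) k) (S vac)) x \<noteq> 0"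
    then obtain k where k: "k \<in> K" "coord (rmult \<theta> k (coord (S' vac) k) (S vac)) x \<noteq> 0"
      unfolding coord_sum by (meson sum.neutral)
    then have "x - k \<in> J" by (auto simp: coord_rmult J_def)
    then show "\<exists>k\<in>K. x \<in> (\<lambda>j. j + k) ` J" using k(1) by (metis diff_add_cancel image_eqI)
  qed
  then have "finite {x. coord (S (S' vac)) x \<noteq> 0}"
    using K J finite_subset by blast
  then show ?thesis using R by (simp add: finite_ops_def right_module_ops_linear)
qed

lemma finite_ops_linear:
  assumes "S \<in> finite_ops \<theta>" "S' \<in> finite_ops \<theta>"
  shows "S + S' \<in> finite_ops \<theta>" "r *\<^sub>R S \<in> finite_ops \<theta>"
proof -
  have fin: "finite ({x. coord (S vac) x \<noteq> 0} \<union> {x. coord (S' vac) x \<noteq> 0})"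
    using assms by (simp add: finite_ops_def)
  show "S + S' \<in> finite_ops \<theta>" "r *\<^sub>R S \<in> finite_ops \<theta>"
    using assms by (auto simp: finite_ops_def right_module_ops_linear blinfun.bilinear_simps
        intro: rev_finite_subset[OF fin])
qed

lemma id_finite_ops: "id_blinfun \<in> finite_ops \<theta>"
  by (simp add: finite_ops_def id_right_module_ops if_distrib)

lemma rot_algebra_right_module_ops: "rot_algebra \<theta> \<subseteq> right_module_ops \<theta>"
  unfolding rot_algebra_def
  by (rule closure_minimal[OF _ closed_right_module_ops]) (auto simp: finite_ops_def)

lemma
  assumes S: "S \<in> rot_algebra \<theta>" and S': "S' \<in> rot_algebra \<theta>"
  shows rot_algebra_add: "S + S' \<in> rot_algebra \<theta>"
    and rot_algebra_scaleR: "r *\<^sub>R S \<in> rot_algebra \<theta>"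
    and rot_algebra_compose: "S o\<^sub>L S' \<in> rot_algebra \<theta>"
proof -
  obtain X X' where X: "\<And>n. X n \<in> finite_ops \<theta>" "X \<longlonglongrightarrow> S" 
    and X': "\<And>n. X' n \<in> finite_ops \<theta>" "X' \<longlonglongrightarrow> S'"
    using S S' unfolding rot_algebra_def closure_sequential by blast
  show "S + S' \<in> rot_algebra \<theta>" 
    unfolding rot_algebra_def closure_sequential
    by (rule exI[of _ "\<lambda>n. X n + X' n"]) (auto intro!: finite_ops_linear X X' tendsto_intros)
  show "r *\<^sub>R S \<in> rot_algebra \<theta>" 
    unfolding rot_algebra_def closure_sequential
    by (rule exI[of _ "\<lambda>n. r *\<^sub>R X n"]) (auto intro!: finite_ops_linear X tendsto_intros)
  show "S o\<^sub>L S' \<in> rot_algebra \<theta>" 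
    unfolding rot_algebra_def closure_sequential
    by (rule exI[of _ "\<lambda>n. X n o\<^sub>L X' n"])
      (auto intro!: finite_ops_compose X X' bounded_bilinear.tendsto[OF bounded_bilinear_blinfun_compose])
qed

lemma id_rot_algebra: "id_blinfun \<in> rot_algebra \<theta>"
  unfolding rot_algebra_def using id_finite_ops closure_subset by blast

lemma rot_algebra_poly: "T \<in> rot_algebra \<theta> \<Longrightarrow> blinfun_poly p T \<in> rot_algebra \<theta>"
proof (induction p)
  case 0
  then show ?case using rot_algebra_scaleR[of T \<theta> T 0] by simp
qed (auto intro!: rot_algebra_add rot_algebra_scaleR rot_algebra_compose id_rot_algebra)

text \<open>This moves all questions about the algebra to operators. An element and its differences
  from the approximants are all images of \<open>vac\<close>, and \<open>op_norm\<close> is the norm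
  of the corresponding operators, so the two notions of limit agree.\<close>

lemma in_A_iff: "in_A \<theta> f \<longleftrightarrow> (\<exists>S\<in>rot_algebra \<theta>. coord (S vac) = f)"
proof
  assume A: "in_A \<theta> f"
  then have cf: "coord (Ell2 f) = f"
    by (intro coord_Ell2) (simp add: in_A_def square_summable_def)
  obtain S where S: "S \<in> right_module_ops \<theta>" "S vac = Ell2 f"
    using right_module_op_exists[of \<theta> "Ell2 f"] A by (auto simp: cf in_A_def)
  obtain F :: "nat \<Rightarrow> coeffs" where F: "\<And>k. finite {x. F k x \<noteq> 0}"
    "\<And>k. bdd_above (op_norm_set \<theta> (\<lambda>x. F k x - f x))" "(\<lambda>k. op_norm \<theta> (\<lambda>x. F k x - f x)) \<longlonglongrightarrow> 0"
    using A unfolding in_A_def by blast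
  have cF: "coord (Ell2 (F k)) = F k" for k
    by (intro coord_Ell2 square_summable_finite F)
  have "\<exists>U. U \<in> right_module_ops \<theta> \<and> U vac = Ell2 (F k) - Ell2 f" for k
  proof -
    have "coord (Ell2 (F k) - Ell2 f) = (\<lambda>x. F k x - f x)" by (simp add: fun_eq_iff cF cf)
    then show ?thesis using right_module_op_exists[of \<theta> "Ell2 (F k) - Ell2 f"] F(2)[of k] by metis
  qed
  then obtain U where U: "\<And>k. U k \<in> right_module_ops \<theta>" "\<And>k. U k vac = Ell2 (F k) - Ell2 f"
    by metis
  have "norm (U k) = op_norm \<theta> (\<lambda>x. F k x - f x)" for k
    using op_norm_right_module_ops(2)[OF U(1), of k] by (simp add: U(2) cF cf coord_simps[abs_def] fun_eq_iff)
  then have "(\<lambda>k. norm (U k)) \<longlonglongrightarrow> 0" using F(3) by simp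
  then have "U \<longlonglongrightarrow> 0" by (rule tendsto_norm_zero_cancel)
  then have "(\<lambda>k. S + U k) \<longlonglongrightarrow> S + 0" by (intro tendsto_intros)
  moreover have "S + U k \<in> finite_ops \<theta>" for k
    using F(1)[of k] by (simp add: finite_ops_def right_module_ops_linear S U blinfun.bilinear_simps cF cf)
  ultimately have "S \<in> rot_algebra \<theta>"
    unfolding rot_algebra_def closure_sequential by (intro exI[of _ "\<lambda>k. S + U k"]) simp
  then show "\<exists>S\<in>rot_algebra \<theta>. coord (S vac) = f"
    using S(2) cf by (intro bexI[of _ S]) simp_all
next
  assume "\<exists>S\<in>rot_algebra \<theta>. coord (S vac) = f"
  then obtain S where S: "S \<in> rot_algebra \<theta>" "coord (S vac) = f" by blast
  obtain X where X: "\<And>n. X n \<in> finite_ops \<theta>" "X \<longlonglongrightarrow> S"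
    using S unfolding rot_algebra_def closure_sequential by blast
  have SR: "S \<in> right_module_ops \<theta>" using S rot_algebra_right_module_ops by blast
  have XR: "X n - S \<in> right_module_ops \<theta>" for n
    using X(1)[of n] SR by (simp add: finite_ops_def right_module_ops_linear)
  have eq: "(\<lambda>x. coord (X n vac) x - f x) = coord ((X n - S) vac)" for n
    by (simp add: fun_eq_iff blinfun.bilinear_simps S(2))
  have "(\<lambda>n. norm (X n - S)) \<longlonglongrightarrow> 0"
    using X(2) by (simp add: LIM_zero tendsto_norm_zero)
  then show "in_A \<theta> f"
    unfolding in_A_def
  proof (intro conjI exI[of _ "\<lambda>n. coord (X n vac)"] allI)
    show "(\<lambda>x. (cmod (f x))\<^sup>2) summable_on UNIV"
      using square_summable_coord[of "S vac"] by (simp add: S(2) square_summable_def)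
    show "bdd_above (op_norm_set \<theta> f)"
      using op_norm_right_module_ops(1)[OF SR] by (simp add: S(2))
    show "finite {x. coord (X k vac) x \<noteq> 0}" for k using X(1)[of k] by (simp add: finite_ops_def)
  qed (simp_all add: eq op_norm_right_module_ops[OF XR])
qed

text \<open>Operators in the algebra are determined by their value at \<open>vac\<close>, so the
  equations for an inverse hold for coefficients exactly when they hold for operators.\<close>

lemma invertible_A_iff:
  assumes S: "S \<in> rot_algebra \<theta>"
  shows "invertible_A \<theta> (coord (S vac))
    \<longleftrightarrow> (\<exists>Y\<in>rot_algebra \<theta>. S o\<^sub>L Y = id_blinfun \<and> Y o\<^sub>L S = id_blinfun)"
proof -
  have eq: "tw_mult \<theta> (coord (X vac)) (coord (Y vac)) = one_c \<longleftrightarrow> X o\<^sub>L Y = id_blinfun"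
    if "X \<in> rot_algebra \<theta>" "Y \<in> rot_algebra \<theta>" for X Y
  proof -
    have R: "X \<in> right_module_ops \<theta>" "Y \<in> right_module_ops \<theta>"
      using that rot_algebra_right_module_ops by auto
    have "tw_mult \<theta> (coord (X vac)) (coord (Y vac)) = one_c \<longleftrightarrow> (X o\<^sub>L Y) vac = id_blinfun vac"
      by (simp add: tw_mult_right_module_ops[OF R(1)] coord_vac[symmetric] coord_inject)
    also have "\<dots> \<longleftrightarrow> X o\<^sub>L Y = id_blinfun"
      using right_module_ops_eqI[OF right_module_ops_linear(4)[OF R] id_right_module_ops] by metis
    finally show ?thesis .
  qed
  show ?thesis
    unfolding invertible_A_def in_A_iff using eq[OF S] eq[OF _ S] by blast
qed

lemma tw_pow_coord:
  assumes "T \<in> right_module_ops \<theta>"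
  shows "tw_pow \<theta> (coord (T vac)) n = coord (blinfun_pow T n vac)"
  by (induction n) (simp_all add: coord_vac tw_mult_right_module_ops[OF assms])

lemma poly_eval_coord:
  assumes "T \<in> right_module_ops \<theta>"
  shows "poly_eval \<theta> p (coord (T vac)) = coord (blinfun_poly p T vac)"
  by (simp add: poly_eval_def fun_eq_iff tw_pow_coord[OF assms] blinfun_poly_def
      blinfun.sum_left coord_sum blinfun.bilinear_simps)

text \<open>Self-adjointness of the coefficients says that the matrix of \<open>S\<close> is
  hermitian; continuity extends symmetry from basis vectors, one argument at a time.\<close>

lemma symmetric_op_coord:
  assumes S: "S \<in> right_module_ops \<theta>" and star: "tw_star \<theta> (coord (S vac)) = coord (S vac)"
  shows "symmetric_op S"
proof -
  let ?f = "coord (S vac)"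
  have f: "?f p = cnj (?f (- p)) * rot \<theta> (- (fst p * snd p))" for p
    using fun_cong[OF star, of p] by (cases p) (simp add: tw_star_def)
  have key: "?f (k - j) * cocycle \<theta> (k - j) j = cnj (?f (j - k) * cocycle \<theta> (j - k) k)" for j k
    unfolding f[of "k - j"] cocycle_def
    by (simp add: cnj_rot mult.assoc flip: rot_add) (simp add: algebra_simps)
  have base: "S (basis j c) \<bullet> basis k d = basis j c \<bullet> S (basis k d)" for j k c d
  proof -
    have "S (basis j c) \<bullet> basis k d = d \<bullet> (?f (k - j) * cocycle \<theta> (k - j) j * c)"
      using right_module_ops_basis[OF S, of j c]
      by (simp add: inner_commute[of _ "basis k d"] inner_basis coord_rmult mult_ac)
    also have "\<dots> = c \<bullet> (?f (j - k) * cocycle \<theta> (j - k) k * d)"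
      unfolding key[of k j] by (simp add: inner_complex_def algebra_simps)
    also have "\<dots> = basis j c \<bullet> S (basis k d)"
      using right_module_ops_basis[OF S, of k d] by (simp add: inner_basis coord_rmult mult_ac)
    finally show ?thesis .
  qed
  have bl: "bounded_linear (\<lambda>x. S x \<bullet> y)" "bounded_linear (\<lambda>x. x \<bullet> S y)"
    "bounded_linear (\<lambda>x. y \<bullet> S x)" "bounded_linear (\<lambda>x. S y \<bullet> x)" for y
    by (auto intro!: bounded_linear_compose[OF bounded_linear_inner_left]
        bounded_linear_compose[OF bounded_linear_inner_right] blinfun.bounded_linear_right
        bounded_linear_inner_left bounded_linear_inner_right)
  have 1: "S (basis j c) \<bullet> x = basis j c \<bullet> S x" for j c x
    using bounded_linear_eqI_basis[OF bl(4) bl(3) base, of j c] by metis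
  have "S x \<bullet> y = x \<bullet> S y" for x y
    using bounded_linear_eqI_basis[OF bl(1) bl(2) 1, of y] by metis
  then show ?thesis by (simp add: symmetric_op_def)
qed

text \<open>By \<open>norm_blinfun_poly_le\<close>, evaluation at \<open>T\<close> is contractive
  for the supremum over the spectrum, so uniform approximants give a Cauchy sequence. The error
  bound is stated for every approximating \<open>p\<close>, which makes \<open>Y\<close> independent
  of the sequence chosen.\<close>

theorem continuous_functional_calculus:
  fixes T :: "hilb \<Rightarrow>\<^sub>L hilb"
  assumes T: "T \<in> rot_algebra \<theta>" "symmetric_op T" and \<phi>: "continuous_on (approx_spectrum T) \<phi>"
  obtains Y where "Y \<in> rot_algebra \<theta>"
    "\<And>p e. 0 \<le> e \<Longrightarrow> (\<And>t. t \<in> approx_spectrum T \<Longrightarrow> \<bar>\<phi> t - poly p t\<bar> \<le> e) \<Longrightarrow> norm (Y - blinfun_poly p T) \<le> e"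
proof -
  define \<sigma> where "\<sigma> = approx_spectrum T"
  have close: "norm (blinfun_poly p T - blinfun_poly q T) \<le> d + e"
    if "0 \<le> d" "0 \<le> e" "\<And>t. t \<in> \<sigma> \<Longrightarrow> \<bar>\<phi> t - poly p t\<bar> \<le> d" "\<And>t. t \<in> \<sigma> \<Longrightarrow> \<bar>\<phi> t - poly q t\<bar> \<le> e" for p q d e
    unfolding blinfun_poly_diff[symmetric]
  proof (rule norm_blinfun_poly_le[OF T(2)])
    show "\<bar>poly (p - q) t\<bar> \<le> d + e" if "t \<in> approx_spectrum T" for t
      using that(1) \<open>\<And>t. t \<in> \<sigma> \<Longrightarrow> \<bar>\<phi> t - poly p t\<bar> \<le> d\<close>[of t]
        \<open>\<And>t. t \<in> \<sigma> \<Longrightarrow> \<bar>\<phi> t - poly q t\<bar> \<le> e\<close>[of t] by (simp add: \<sigma>_def)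
  qed (use that in simp)
  have "\<exists>p. \<forall>t\<in>\<sigma>. \<bar>\<phi> t - poly p t\<bar> \<le> 1 / real (Suc n)" for n
    using real_poly_approximation[OF compact_approx_spectrum \<phi>, of "1 / real (Suc n)"]
    unfolding \<sigma>_def by (metis of_nat_0_less_iff zero_less_Suc zero_less_divide_1_iff)
  then obtain P where P: "\<And>n t. t \<in> \<sigma> \<Longrightarrow> \<bar>\<phi> t - poly (P n) t\<bar> \<le> 1 / real (Suc n)" by metis
  define X where "X n = blinfun_poly (P n) T" for n
  have "Cauchy X"
  proof (rule CauchyI)
    fix e :: real assume e: "0 < e"
    then obtain N where N: "inverse (real (Suc N)) < e / 2" using reals_Archimedean[of "e / 2"] by auto
    have "norm (X m - X n) < e" if "m \<ge> N" "n \<ge> N" for m n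
    proof -
      have "norm (X m - X n) \<le> 1 / real (Suc m) + 1 / real (Suc n)"
        unfolding X_def by (rule close) (use P in auto)
      also have "\<dots> \<le> 1 / real (Suc N) + 1 / real (Suc N)"
        using that by (intro add_mono divide_left_mono) auto
      also have "\<dots> < e" using N by (simp add: inverse_eq_divide)
      finally show ?thesis .
    qed
    then show "\<exists>M. \<forall>m\<ge>M. \<forall>n\<ge>M. norm (X m - X n) < e" by blast
  qed
  then obtain Y where Y: "X \<longlonglongrightarrow> Y" using Cauchy_convergent convergent_def by blast
  have "X n \<in> rot_algebra \<theta>" for n by (simp add: X_def rot_algebra_poly T)
  then have "Y \<in> rot_algebra \<theta>"
    using Y closed_sequentially[of "rot_algebra \<theta>" X Y] by (simp add: rot_algebra_def)
  moreover have "norm (Y - blinfun_poly p T) \<le> e"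
    if e: "0 \<le> e" and p: "\<And>t. t \<in> approx_spectrum T \<Longrightarrow> \<bar>\<phi> t - poly p t\<bar> \<le> e" for p e
  proof (rule tendsto_le[OF sequentially_bot])
    show "(\<lambda>n. norm (X n - blinfun_poly p T)) \<longlonglongrightarrow> norm (Y - blinfun_poly p T)"
      by (intro tendsto_intros Y)
    show "(\<lambda>n. 1 / real (Suc n) + e) \<longlonglongrightarrow> e"
      using tendsto_add[OF LIMSEQ_inverse_real_of_nat tendsto_const[of e]] by (simp add: inverse_eq_divide)
    show "\<forall>\<^sub>F n in sequentially. norm (X n - blinfun_poly p T) \<le> 1 / real (Suc n) + e"
      unfolding X_def by (intro always_eventually allI close) (use e p P in \<open>auto simp: \<sigma>_def\<close>)
  qed
  ultimately show thesis using that by blast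
qed

text \<open>For \<open>t\<close> outside the approximate spectrum, the functional calculus of
  \<open>1 / (u - t)\<close> supplies an inverse within the algebra. Conversely a left inverse
  bounds \<open>Q\<close> from below.\<close>

lemma spec_iff_approx_spectrum:
  assumes T: "T \<in> rot_algebra \<theta>" "symmetric_op T"
  shows "complex_of_real t \<in> spec \<theta> (coord (T vac)) \<longleftrightarrow> t \<in> approx_spectrum T"
proof -
  define Q where "Q = blinfun_poly [:- t, 1:] T"
  have Q: "Q \<in> rot_algebra \<theta>" by (simp add: Q_def rot_algebra_poly T del: blinfun_poly_pCons)
  have QT: "Q = T - t *\<^sub>R id_blinfun" by (simp add: Q_def blinfun_compose_simps)
  have "(\<lambda>z. coord (T vac) z - complex_of_real t * one_c z) = coord (Q vac)"
    by (simp add: fun_eq_iff QT blinfun.bilinear_simps coord_vac)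
  then have spec: "complex_of_real t \<in> spec \<theta> (coord (T vac))
      \<longleftrightarrow> \<not> (\<exists>Y\<in>rot_algebra \<theta>. Q o\<^sub>L Y = id_blinfun \<and> Y o\<^sub>L Q = id_blinfun)"
    by (simp add: spec_def invertible_A_iff[OF Q])
  have "\<exists>Y\<in>rot_algebra \<theta>. Q o\<^sub>L Y = id_blinfun \<and> Y o\<^sub>L Q = id_blinfun" if t: "t \<notin> approx_spectrum T"
  proof -
    define \<phi> where "\<phi> u = 1 / (u - t)" for u
    have "continuous_on (approx_spectrum T) \<phi>"
      unfolding \<phi>_def using t by (intro continuous_intros) auto
    then obtain Y where Y: "Y \<in> rot_algebra \<theta>"
      "\<And>p e. 0 \<le> e \<Longrightarrow> (\<And>u. u \<in> approx_spectrum T \<Longrightarrow> \<bar>\<phi> u - poly p u\<bar> \<le> e) \<Longrightarrow> norm (Y - blinfun_poly p T) \<le> e"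
      using continuous_functional_calculus[OF T] by blast
    obtain K where K: "\<And>u. u \<in> approx_spectrum T \<Longrightarrow> \<bar>u - t\<bar> \<le> K" "0 \<le> K"
    proof -
      obtain B where B: "0 < B" "\<And>u. u \<in> approx_spectrum T \<Longrightarrow> \<bar>u\<bar> \<le> B"
        using compact_imp_bounded[OF compact_approx_spectrum[of T]] unfolding bounded_pos by auto
      show thesis
      proof (rule that[of "B + \<bar>t\<bar>"])
        show "\<bar>u - t\<bar> \<le> B + \<bar>t\<bar>" if "u \<in> approx_spectrum T" for u using B(2)[OF that] by linarith
      qed (use B in simp)
    qed
    \<comment> \<open>For \<open>p\<close> close to \<open>\<phi>\<close>, the operator
      \<open>Q p(T) - 1\<close> is a polynomial in \<open>T\<close> whose size on the spectrum is
      \<open>\<bar>u - t\<bar>\<close> times the error of \<open>p\<close>; the rest is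
      \<open>Q\<close> times \<open>Y - p(T)\<close>.\<close>
    have bound: "norm ((Q o\<^sub>L Y) - id_blinfun) \<le> e * (norm Q + K)"
      "norm ((Y o\<^sub>L Q) - id_blinfun) \<le> e * (norm Q + K)" if e: "0 < e" for e
    proof -
      obtain p where p: "\<And>u. u \<in> approx_spectrum T \<Longrightarrow> \<bar>\<phi> u - poly p u\<bar> \<le> e"
        using real_poly_approximation[OF compact_approx_spectrum \<open>continuous_on _ \<phi>\<close> e] by blast
      let ?P = "blinfun_poly p T"
      have YP: "norm (Y - ?P) \<le> e" using Y(2)[OF _ p] e by simp
      have comm: "Q o\<^sub>L ?P = blinfun_poly ([:- t, 1:] * p) T" "?P o\<^sub>L Q = blinfun_poly ([:- t, 1:] * p) T"
        unfolding Q_def blinfun_poly_mult[symmetric] by (simp_all only: mult.commute)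
      have one: "blinfun_poly 1 T = id_blinfun" unfolding one_pCons by simp
      have diff: "blinfun_poly ([:- t, 1:] * p - 1) T = (Q o\<^sub>L ?P) - id_blinfun"
        "blinfun_poly ([:- t, 1:] * p - 1) T = (?P o\<^sub>L Q) - id_blinfun"
        by (simp_all only: blinfun_poly_diff comm one)
      have small: "norm (blinfun_poly ([:- t, 1:] * p - 1) T) \<le> e * K"
      proof (rule norm_blinfun_poly_le[OF T(2)])
        fix u assume u: "u \<in> approx_spectrum T"
        have ut: "u - t \<noteq> 0" using u t by auto
        have "poly ([:- t, 1:] * p - 1) u = (u - t) * poly p u - 1" by (simp add: algebra_simps)
        also have "\<dots> = - (u - t) * (\<phi> u - poly p u)" using ut by (simp add: \<phi>_def field_simps)
        finally have "\<bar>poly ([:- t, 1:] * p - 1) u\<bar> = \<bar>u - t\<bar> * \<bar>\<phi> u - poly p u\<bar>"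
          by (simp add: abs_mult abs_minus_commute)
        also have "\<dots> \<le> K * e" using K u p[OF u] by (intro mult_mono) auto
        finally show "\<bar>poly ([:- t, 1:] * p - 1) u\<bar> \<le> e * K" by (simp add: mult.commute)
      qed (use K e in simp)
      have "norm ((Q o\<^sub>L Y) - id_blinfun) = norm ((Q o\<^sub>L (Y - ?P)) + blinfun_poly ([:- t, 1:] * p - 1) T)"
        unfolding diff(1) by (simp add: blinfun_compose_simps)
      also have "\<dots> \<le> norm Q * e + e * K"
        using norm_triangle_ineq[of "Q o\<^sub>L (Y - ?P)"] norm_blinfun_compose[of Q "Y - ?P"]
          mult_left_mono[OF YP norm_ge_zero[of Q]] small by (smt (verit))
      finally show "norm ((Q o\<^sub>L Y) - id_blinfun) \<le> e * (norm Q + K)" by (simp add: algebra_simps)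
      have "norm ((Y o\<^sub>L Q) - id_blinfun) = norm (((Y - ?P) o\<^sub>L Q) + blinfun_poly ([:- t, 1:] * p - 1) T)"
        unfolding diff(2) by (simp add: blinfun_compose_simps)
      also have "\<dots> \<le> e * norm Q + e * K"
        using norm_triangle_ineq[of "(Y - ?P) o\<^sub>L Q"] norm_blinfun_compose[of "Y - ?P" Q]
          mult_right_mono[OF YP norm_ge_zero[of Q]] small by (smt (verit))
      finally show "norm ((Y o\<^sub>L Q) - id_blinfun) \<le> e * (norm Q + K)" by (simp add: algebra_simps)
    qed
    have zero: "x = 0" if le: "\<And>e. 0 < e \<Longrightarrow> norm x \<le> e * C" and C: "0 \<le> C" for x :: "hilb \<Rightarrow>\<^sub>L hilb" and C :: real
    proof -
      have "norm x \<le> 0 + e" if "0 < e" for e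
      proof -
        have "norm x \<le> e / (C + 1) * C" using that C by (intro le) simp
        also have "\<dots> \<le> e" using that C by (simp add: field_simps)
        finally show ?thesis by simp
      qed
      then have "norm x \<le> 0" by (rule field_le_epsilon)
      then show ?thesis by simp
    qed
    have "(Q o\<^sub>L Y) - id_blinfun = 0" "(Y o\<^sub>L Q) - id_blinfun = 0"
      by (rule zero[of _ "norm Q + K"]; use bound K in simp)+
    then show ?thesis using Y(1) by auto
  qed
  moreover have "t \<notin> approx_spectrum T" if "Y o\<^sub>L Q = id_blinfun" for Y
  proof -
    have "bounded_below Q"
    proof (rule bounded_belowI[of "1 / (norm Y + 1)"])
      fix x
      have "norm x = norm (Y (Q x))"
        using that by (metis blinfun_apply_blinfun_compose blinfun_apply_id_blinfun id_apply)
      also have "\<dots> \<le> norm Y * norm (Q x)" by (rule norm_blinfun)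
      also have "\<dots> \<le> (norm Y + 1) * norm (Q x)" by (intro mult_right_mono) auto
      finally show "1 / (norm Y + 1) * norm x \<le> norm (Q x)"
        by (simp add: pos_divide_le_eq add_nonneg_pos mult.commute)
    qed (simp add: add_nonneg_pos)
    then show ?thesis by (simp add: approx_spectrum_def QT)
  qed
  ultimately show ?thesis unfolding spec by blast
qed

text \<open>Discharges the description in \<open>cfc\<close>: approximants exist by Weierstrass, and
  any two candidates are within \<open>e / 2\<close> of a common \<open>p(T)\<close> for each
  \<open>e\<close>, hence equal.\<close>

theorem cfc_eq:
  assumes T: "T \<in> rot_algebra \<theta>" "symmetric_op T"
    and Y: "Y \<in> rot_algebra \<theta>"
    and \<phi>: "continuous_on (approx_spectrum T) \<phi>"
    and approx: "\<And>p e. 0 \<le> e \<Longrightarrow> (\<And>t. t \<in> approx_spectrum T \<Longrightarrow> \<bar>\<phi> t - poly p t\<bar> \<le> e) \<Longrightarrow> norm (Y - blinfun_poly p T) \<le> e"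
  shows "cfc \<theta> \<phi> (coord (T vac)) = coord (Y vac)"
  unfolding cfc_def
proof (rule the_equality)
  have TR: "T \<in> right_module_ops \<theta>" using T rot_algebra_right_module_ops by blast
  have R: "S - blinfun_poly p T \<in> right_module_ops \<theta>" if "S \<in> rot_algebra \<theta>" for S p
    using that rot_algebra_poly[OF T(1), of p] rot_algebra_right_module_ops right_module_ops_linear(2) by blast
  have eq: "(\<lambda>z. coord (S vac) z - poly_eval \<theta> p (coord (T vac)) z) = coord (blinfun_apply (S - blinfun_poly p T) vac)"
    for p and S :: "hilb \<Rightarrow>\<^sub>L hilb"
    by (simp add: fun_eq_iff poly_eval_coord[OF TR] blinfun.bilinear_simps)
  show "in_A \<theta> (coord (Y vac)) \<and> (\<forall>\<epsilon>>0. \<exists>p::real poly.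
       (\<forall>t. complex_of_real t \<in> spec \<theta> (coord (T vac)) \<longrightarrow> \<bar>\<phi> t - poly p t\<bar> \<le> \<epsilon>) \<and>
       bdd_above (op_norm_set \<theta> (\<lambda>z. coord (Y vac) z - poly_eval \<theta> p (coord (T vac)) z)) \<and>
       op_norm \<theta> (\<lambda>z. coord (Y vac) z - poly_eval \<theta> p (coord (T vac)) z) \<le> \<epsilon>)"
  proof (intro conjI allI impI)
    show "in_A \<theta> (coord (Y vac))" unfolding in_A_iff using Y by blast
    fix e :: real assume e: "0 < e"
    obtain p where p: "\<And>t. t \<in> approx_spectrum T \<Longrightarrow> \<bar>\<phi> t - poly p t\<bar> \<le> e"
      using real_poly_approximation[OF compact_approx_spectrum \<phi> e] by blast
    show "\<exists>p::real poly. (\<forall>t. complex_of_real t \<in> spec \<theta> (coord (T vac)) \<longrightarrow> \<bar>\<phi> t - poly p t\<bar> \<le> e) \<and>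
       bdd_above (op_norm_set \<theta> (\<lambda>z. coord (Y vac) z - poly_eval \<theta> p (coord (T vac)) z)) \<and>
       op_norm \<theta> (\<lambda>z. coord (Y vac) z - poly_eval \<theta> p (coord (T vac)) z) \<le> e"
      unfolding spec_iff_approx_spectrum[OF T] eq op_norm_right_module_ops(2)[OF R[OF Y]]
      by (intro exI[of _ p] conjI allI impI p op_norm_right_module_ops(1)[OF R[OF Y]]
          approx[OF less_imp_le[OF e]])
  qed
  fix y assume "in_A \<theta> y \<and> (\<forall>\<epsilon>>0. \<exists>p::real poly.
       (\<forall>t. complex_of_real t \<in> spec \<theta> (coord (T vac)) \<longrightarrow> \<bar>\<phi> t - poly p t\<bar> \<le> \<epsilon>) \<and>
       bdd_above (op_norm_set \<theta> (\<lambda>z. y z - poly_eval \<theta> p (coord (T vac)) z)) \<and>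
       op_norm \<theta> (\<lambda>z. y z - poly_eval \<theta> p (coord (T vac)) z) \<le> \<epsilon>)"
  moreover from this obtain Z where Z: "Z \<in> rot_algebra \<theta>" "y = coord (Z vac)"
    unfolding in_A_iff by blast
  ultimately have H: "\<exists>p. (\<forall>t\<in>approx_spectrum T. \<bar>\<phi> t - poly p t\<bar> \<le> e) \<and> norm (Z - blinfun_poly p T) \<le> e" if "0 < e" for e
    using that unfolding spec_iff_approx_spectrum[OF T] Z(2) eq op_norm_right_module_ops(2)[OF R[OF Z(1)]] by blast
  have "norm (Z - Y) \<le> 0 + e" if "0 < e" for e
  proof -
    obtain p where p: "\<forall>t\<in>approx_spectrum T. \<bar>\<phi> t - poly p t\<bar> \<le> e / 2" "norm (Z - blinfun_poly p T) \<le> e / 2"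
      using H[OF half_gt_zero[OF \<open>0 < e\<close>]] by blast
    have "norm (Y - blinfun_poly p T) \<le> e / 2" using approx[of "e / 2" p] p(1) that by simp
    then show ?thesis
      using p(2) norm_triangle_ineq4[of "Z - blinfun_poly p T" "Y - blinfun_poly p T"] by simp
  qed
  then have "norm (Z - Y) \<le> 0" by (rule field_le_epsilon)
  then show "y = coord (Y vac)" using Z(2) by simp
qed

section \<open>The logarithmic Sobolev inequality\<close>

text \<open>The finite bound is applied to truncations of \<open>b\<close>, whose sums
  \<open>S'\<close> and \<open>D'\<close> are at most \<open>S\<close> and \<open>D\<close>; then
  the window grows while \<open>K\<close> stays fixed.\<close>

lemma hermitian_convolution_bound_infsum:
  fixes b :: "int \<Rightarrow> complex"
  assumes herm: "\<And>n. b (- n) = cnj (b n)"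
    and S: "((\<lambda>n. (cmod (b n))\<^sup>2) has_sum S) UNIV"
    and D: "((\<lambda>n. real_of_int \<bar>n\<bar> * (cmod (b n))\<^sup>2) has_sum D) UNIV"
    and K: "finite K"
  shows "(\<Sum>k\<in>K. (cmod (\<Sum>\<^sub>\<infinity>m. b m * b (k - m)))\<^sup>2) \<le> S\<^sup>2 + 4 * D * S + 8 * D\<^sup>2"
proof (rule tendsto_upperbound)
  \<comment> \<open>The indices for which both factors lie in the window, so that summing over them
    is the truncated convolution at \<open>k\<close>. For fixed \<open>k\<close> these sets exhaust
    the integers.\<close>
  define A where "A N k = {m. \<bar>m\<bar> \<le> int N \<and> \<bar>k - m\<bar> \<le> int N}" for N k
  have finA: "finite (A N k)" for N k
    by (rule finite_subset[of _ "{- int N..int N}"]) (auto simp: A_def)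
  have "filterlim (\<lambda>N. A N k) (finite_subsets_at_top UNIV) sequentially" for k
    unfolding filterlim_finite_subsets_at_top
  proof (intro allI impI)
    fix X :: "int set" assume X: "finite X \<and> X \<subseteq> UNIV"
    have "\<forall>\<^sub>F N in sequentially. m \<in> A N k" for m
      by (rule eventually_sequentiallyI[of "nat (\<bar>m\<bar> + \<bar>k - m\<bar>)"]) (auto simp: A_def)
    then have "\<forall>\<^sub>F N in sequentially. \<forall>m\<in>X. m \<in> A N k"
      using X by (intro eventually_ball_finite) auto
    then show "\<forall>\<^sub>F N in sequentially. finite (A N k) \<and> X \<subseteq> A N k \<and> A N k \<subseteq> UNIV"
      by eventually_elim (auto simp: finA)
  qed
  moreover have "((\<lambda>m. b m * b (k - m)) has_sum (\<Sum>\<^sub>\<infinity>m. b m * b (k - m))) UNIV" for k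
  proof (rule has_sum_infsum, rule abs_summable_summable, rule summable_on_comparison_test)
    have "(\<lambda>m. (cmod (b (k - m)))\<^sup>2) summable_on UNIV"
      using has_sum_reindex_bij_witness[of UNIV "\<lambda>m. k - m" "\<lambda>m. k - m" UNIV "\<lambda>m. (cmod (b (k - m)))\<^sup>2" "\<lambda>m. (cmod (b m))\<^sup>2" S S] S
      by (auto intro: has_sum_imp_summable)
    then show "(\<lambda>m. (cmod (b m))\<^sup>2 + (cmod (b (k - m)))\<^sup>2) summable_on UNIV"
      by (intro summable_on_add has_sum_imp_summable[OF S])
    show "norm (b m * b (k - m)) \<le> (cmod (b m))\<^sup>2 + (cmod (b (k - m)))\<^sup>2" for m
      using sum_squares_bound[of "cmod (b m)" "cmod (b (k - m))"]
        mult_nonneg_nonneg[OF norm_ge_zero[of "b m"] norm_ge_zero[of "b (k - m)"]]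
      unfolding norm_mult by linarith
  qed auto
  ultimately have "(\<lambda>N. \<Sum>m\<in>A N k. b m * b (k - m)) \<longlonglongrightarrow> (\<Sum>\<^sub>\<infinity>m. b m * b (k - m))" for k
    unfolding has_sum_def by (rule filterlim_compose[rotated])
  then show "(\<lambda>N. \<Sum>k\<in>K. (cmod (\<Sum>m\<in>A N k. b m * b (k - m)))\<^sup>2)
      \<longlonglongrightarrow> (\<Sum>k\<in>K. (cmod (\<Sum>\<^sub>\<infinity>m. b m * b (k - m)))\<^sup>2)"
    by (intro tendsto_intros)
  have "\<forall>\<^sub>F N in sequentially. \<forall>k\<in>K. \<bar>k\<bar> \<le> 2 * int N"
  proof (intro eventually_ball_finite[OF K] ballI)
    show "\<forall>\<^sub>F N in sequentially. \<bar>k\<bar> \<le> 2 * int N" for k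
      by (rule eventually_sequentiallyI[of "nat \<bar>k\<bar>"]) auto
  qed
  then show "\<forall>\<^sub>F N in sequentially. (\<Sum>k\<in>K. (cmod (\<Sum>m\<in>A N k. b m * b (k - m)))\<^sup>2) \<le> S\<^sup>2 + 4 * D * S + 8 * D\<^sup>2"
  proof eventually_elim
    case (elim N)
    define c where "c n = (if \<bar>n\<bar> \<le> int N then b n else 0)" for n
    have conv: "(\<Sum>m\<in>A N k. b m * b (k - m)) = (\<Sum>n\<in>{- int N..int N}. c n * c (k - n))" for k
      by (rule sum.mono_neutral_cong_left) (auto simp: A_def c_def)
    define S' where "S' = (\<Sum>n\<in>{- int N..int N}. (cmod (c n))\<^sup>2)"
    define D' where "D' = (\<Sum>n\<in>{- int N..int N}. real_of_int \<bar>n\<bar> * (cmod (c n))\<^sup>2)"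
    have "S' = (\<Sum>n\<in>{- int N..int N}. (cmod (b n))\<^sup>2)"
      unfolding S'_def by (rule sum.cong) (auto simp: c_def)
    then have S': "0 \<le> S'" "S' \<le> S"
      using finite_sum_le_has_sum[OF S, of "{- int N..int N}"] by (auto intro: sum_nonneg)
    have "D' = (\<Sum>n\<in>{- int N..int N}. real_of_int \<bar>n\<bar> * (cmod (b n))\<^sup>2)"
      unfolding D'_def by (rule sum.cong) (auto simp: c_def)
    then have D': "0 \<le> D'" "D' \<le> D"
      using finite_sum_le_has_sum[OF D, of "{- int N..int N}"] by (auto intro: sum_nonneg)
    have "(\<Sum>k\<in>K. (cmod (\<Sum>m\<in>A N k. b m * b (k - m)))\<^sup>2)
      \<le> (\<Sum>k\<in>{- 2 * int N..2 * int N}. (cmod (\<Sum>n\<in>{- int N..int N}. c n * c (k - n)))\<^sup>2)"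
      unfolding conv using elim by (intro sum_mono2) (auto simp: abs_le_iff)
    also have "\<dots> \<le> S'\<^sup>2 + 4 * D' * S' + 8 * D'\<^sup>2"
      unfolding S'_def D'_def by (rule hermitian_convolution_bound) (auto simp: c_def herm)
    also have "\<dots> \<le> S\<^sup>2 + 4 * D * S + 8 * D\<^sup>2"
      using S' D' by (intro add_mono mult_mono power_mono) auto
    finally show ?case .
  qed
qed simp

section \<open>Decay of the coefficients along the line\<close>

lemma summable_on_int_inverse_square: "(\<lambda>n::int. 1 / (1 + (real_of_int n)\<^sup>2)) summable_on UNIV"
proof -
  let ?f = "\<lambda>n::int. 1 / (1 + (real_of_int n)\<^sup>2)"
  have "summable (\<lambda>n::nat. 1 / (1 + (real n)\<^sup>2))"
  proof (rule summable_comparison_test[OF _ inverse_power_summable[of 2]])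
    show "\<exists>N. \<forall>n\<ge>N. norm (1 / (1 + (real n)\<^sup>2)) \<le> inverse ((real n)\<^sup>2)"
      by (intro exI[of _ 1]) (auto simp: divide_simps abs_of_pos add_pos_nonneg)
  qed simp
  then have nat: "(\<lambda>n::nat. 1 / (1 + (real n)\<^sup>2)) summable_on UNIV"
    by (subst summable_on_UNIV_nonneg_real_iff) auto
  have "?f summable_on range int" "?f summable_on range (\<lambda>n. - int n)"
    using nat by (auto simp: summable_on_reindex inj_on_def o_def)
  then have "?f summable_on (range int \<union> range (\<lambda>n. - int n))" by (rule summable_on_union)
  moreover have "range int \<union> range (\<lambda>n. - int n) = UNIV"
  proof -
    have "x \<in> range int \<union> range (\<lambda>n. - int n)" for x
      by (cases x rule: int_cases2) auto
    then show ?thesis by blast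
  qed
  ultimately show ?thesis by simp
qed

lemma smooth_line_summable:
  assumes "smooth a"
  shows "(\<lambda>n. real_of_int \<bar>n\<bar> * (cmod (a (n, s * n)))\<^sup>2) summable_on UNIV"
proof -
  \<comment> \<open>Decay of order two: one power of the weight absorbs
    \<open>\<bar>n\<bar>\<close>, the other leaves a summable bound.\<close>
  obtain C where C: "\<And>m n. (1 + (real_of_int m)\<^sup>2 + (real_of_int n)\<^sup>2)\<^sup>2 * (cmod (a (m, n)))\<^sup>2 \<le> C"
    using assms unfolding smooth_def bdd_above_def by fastforce
  show ?thesis
  proof (rule summable_on_comparison_test)
    show "(\<lambda>n. C * (1 / (1 + (real_of_int n)\<^sup>2))) summable_on UNIV"
      by (intro summable_on_cmult_right summable_on_int_inverse_square)
    fix n :: int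
    let ?w = "1 + (real_of_int n)\<^sup>2" and ?v = "(cmod (a (n, s * n)))\<^sup>2"
    have w: "?w > 0" by (simp add: add_pos_nonneg)
    have "\<bar>real_of_int n\<bar> \<le> ?w"
      using sum_squares_bound[of 1 "\<bar>real_of_int n\<bar>"] by simp
    then have "(\<bar>real_of_int n\<bar> * ?v) * ?w \<le> (?w * ?v) * ?w"
      using w by (intro mult_right_mono) auto
    also have "\<dots> = ?w\<^sup>2 * ?v" by (simp add: power2_eq_square)
    also have "\<dots> \<le> (?w + (real_of_int (s * n))\<^sup>2)\<^sup>2 * ?v"
      using w by (intro mult_right_mono power_mono) auto
    also have "\<dots> \<le> C" using C[of n "s * n"] by simp
    finally show "real_of_int \<bar>n\<bar> * ?v \<le> C * (1 / ?w)"
      using w by (simp add: pos_le_divide_eq)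
  qed simp
qed

text \<open>Pairing \<open>S vac\<close> with \<open>basis 0 \<i>\<close> extracts the imaginary
  part. Moving \<open>S\<close> across and commuting it with multiplication by \<open>\<i>\<close>
  reverses the sign.\<close>

lemma coord_symmetric_real:
  assumes "S \<in> right_module_ops \<theta>" "symmetric_op S"
  shows "Im (coord (S vac) 0) = 0"
proof -
  have "Im (coord (S vac) 0) = basis 0 \<i> \<bullet> S vac"
    by (simp add: inner_basis inner_complex_def)
  also have "\<dots> = S (basis 0 \<i>) \<bullet> vac" using assms(2) by (simp add: symmetric_op_def)
  also have "\<dots> = vac \<bullet> rmult \<theta> 0 \<i> (S vac)"
    using right_module_ops_basis[OF assms(1), of 0 \<i>] by (simp add: inner_commute)
  also have "\<dots> = - Im (coord (S vac) 0)"
    by (simp add: inner_basis inner_complex_def coord_rmult cocycle_def)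
  finally show ?thesis by simp
qed

text \<open>The function \<open>n (n - 1) / 2\<close> has polarisation \<open>n m\<close>; it
  therefore absorbs the phases that arise on multiplying powers of a single monomial.\<close>

lemma triangular_add:
  fixes n m :: int
  shows "(n + m) * (n + m - 1) div 2 = n * (n - 1) div 2 + m * (m - 1) div 2 + n * m"
proof -
  have e: "2 * (k * (k - 1) div 2) = k * (k - 1)" for k :: int by simp
  have "(n + m) * (n + m - 1) = n * (n - 1) + m * (m - 1) + 2 * (n * m)"
    by (simp add: algebra_simps)
  then show ?thesis using e[of n] e[of m] e[of "n + m"] by linarith
qed

lemma line_infsum:
  fixes g :: "int \<times> int \<Rightarrow> 'a::{comm_monoid_add,t2_space}"
  assumes "\<And>m n. n \<noteq> s * m \<Longrightarrow> g (m, n) = 0"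
  shows "infsum g UNIV = (\<Sum>\<^sub>\<infinity>m. g (m, s * m))"
proof -
  have "infsum g UNIV = infsum g (range (\<lambda>m. (m, s * m)))"
    using assms by (intro infsum_cong_neutral) force+
  also have "\<dots> = (\<Sum>\<^sub>\<infinity>m. g (m, s * m))"
    by (subst infsum_reindex) (auto simp: inj_on_def o_def)
  finally show ?thesis .
qed

text \<open>On the line the cocycle is a coboundary: after a change of phases, twisted convolution
  becomes ordinary convolution of a hermitian sequence with the same moduli. Here \<open>w\<close>
  is the square of \<open>a\<close>, and its squared norm is the trace of the fourth power.\<close>

lemma line_square_norm_bound:
  assumes line: "\<And>m n. n \<noteq> s * m \<Longrightarrow> a (m, n) = 0"
    and star: "tw_star \<theta> a = a"
    and S: "((\<lambda>n. (cmod (a (n, s * n)))\<^sup>2) has_sum S) UNIV"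
    and D: "((\<lambda>n. real_of_int \<bar>n\<bar> * (cmod (a (n, s * n)))\<^sup>2) has_sum D) UNIV"
    and w: "coord w = tw_mult \<theta> a a"
  shows "(norm w)\<^sup>2 \<le> S\<^sup>2 + 4 * D * S + 8 * D\<^sup>2"
proof -
  define q :: "int \<Rightarrow> int" where "q n = n * (n - 1) div 2" for n
  have q: "q (n + m) = q n + q m + n * m" for n m
    unfolding q_def by (rule triangular_add)
  \<comment> \<open>\<open>(U V\<^sup>s)\<^sup>n = \<lambda>\<^bsup>- s n (n - 1) / 2\<^esup> U\<^sup>n V\<^bsup>s n\<^esup>\<close>, so \<open>b n\<close> is the coefficient of \<open>(U V\<^sup>s)\<^sup>n\<close>\<close>
  define b where "b n = a (n, s * n) * rot \<theta> (s * q n)" for n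
  have nb: "cmod (b n) = cmod (a (n, s * n))" for n by (simp add: b_def norm_mult)
  \<comment> \<open>The reflection rule for \<open>q\<close> matches the phase in
    \<open>tw_star\<close>.\<close>
  have herm: "b (- n) = cnj (b n)" for n
  proof -
    have "q (- n) = n * n - q n" using q[of n "- n"] by (simp add: q_def)
    moreover have "a (- n, s * - n) = cnj (a (n, s * n)) * rot \<theta> (- (n * (s * n)))"
      using fun_cong[OF star, of "(- n, s * - n)"] by (simp add: tw_star_def)
    ultimately show ?thesis
      by (simp add: b_def cnj_rot mult.assoc flip: rot_add) (simp add: algebra_simps)
  qed
  have conv: "cmod (coord w (k, l)) = (if l = s * k then cmod (\<Sum>\<^sub>\<infinity>m. b m * b (k - m)) else 0)" for k l
  proof -
    let ?g = "\<lambda>p. a p * (a ((k, l) - p) * cocycle \<theta> p ((k, l) - p))"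
    have "coord w (k, l) = (\<Sum>\<^sub>\<infinity>m. ?g (m, s * m))"
      unfolding w tw_mult_eq by (rule line_infsum) (simp add: line)
    also have "\<dots> = (if l = s * k then rot \<theta> (- (s * q k)) * (\<Sum>\<^sub>\<infinity>m. b m * b (k - m)) else 0)"
    proof (cases "l = s * k")
      case True
      \<comment> \<open>Additivity of \<open>q\<close> up to \<open>m (k - m)\<close> splits off a
        phase depending on \<open>k\<close> alone, which the modulus discards.\<close>
      have "?g (m, s * m) = rot \<theta> (- (s * q k)) * (b m * b (k - m))" for m
      proof -
        have "- (s * m * (k - m)) = - (s * q k) + (s * q m + s * q (k - m))"
        proof -
          have qk: "q k = q m + q (k - m) + m * (k - m)" using q[of m "k - m"] by simp
          show ?thesis unfolding qk by (simp add: algebra_simps)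
        qed
        then have "cocycle \<theta> (m, s * m) (k - m, s * (k - m))
            = rot \<theta> (- (s * q k)) * (rot \<theta> (s * q m) * rot \<theta> (s * q (k - m)))"
          unfolding cocycle_def fst_conv snd_conv by (simp only: rot_add)
        moreover have "(k, l) - (m, s * m) = (k - m, s * (k - m))"
          by (simp add: True algebra_simps)
        ultimately show ?thesis by (simp add: b_def)
      qed
      then show ?thesis using True by (simp add: infsum_cmult_right')
    next
      case False
      then have g: "?g (m, s * m) = 0" for m by (simp add: line algebra_simps)
      show ?thesis unfolding g using False by simp
    qed
    finally show ?thesis by (simp add: norm_mult)
  qed
  have off: "l = s * k" if "coord w (k, l) \<noteq> 0" for k l
    using conv[of k l] that by (auto split: if_splits)
  have "(\<Sum>x\<in>F. (cmod (coord w x))\<^sup>2) \<le> S\<^sup>2 + 4 * D * S + 8 * D\<^sup>2" if F: "finite F" for F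
  proof -
    have "(\<Sum>x\<in>F. (cmod (coord w x))\<^sup>2) = (\<Sum>x\<in>{x\<in>F. snd x = s * fst x}. (cmod (coord w x))\<^sup>2)"
      using F by (intro sum.mono_neutral_right) (auto dest: off)
    also have "\<dots> \<le> (\<Sum>x\<in>(\<lambda>k. (k, s * k)) ` fst ` F. (cmod (coord w x))\<^sup>2)"
      using F by (intro sum_mono2) force+
    also have "\<dots> = (\<Sum>k\<in>fst ` F. (cmod (\<Sum>\<^sub>\<infinity>m. b m * b (k - m)))\<^sup>2)"
      by (subst sum.reindex) (auto simp: inj_on_def conv)
    also have "\<dots> \<le> S\<^sup>2 + 4 * D * S + 8 * D\<^sup>2"
      using F S D by (intro hermitian_convolution_bound_infsum herm) (simp_all add: nb)
    finally show ?thesis .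
  qed
  then show ?thesis unfolding norm_ell2_sq by (rule square_summableI(2))
qed

theorem theorem3p2:
  fixes \<theta> :: real and s :: int and a :: coeffs
  assumes "\<theta> \<notin> \<rat>" and "s \<noteq> 0"
    and "smooth a"
    and "\<forall>m n. n \<noteq> s * m \<longrightarrow> a (m, n) = 0"
    and "strictly_pos \<theta> a"
  shows "tau (tw_mult \<theta> (tw_mult \<theta> a a) (cfc \<theta> ln a))
     \<le> complex_of_real
         ((\<Sum>\<^sub>\<infinity>n\<in>(UNIV::int set). (1 + real_of_int \<bar>s\<bar>) * real_of_int \<bar>n\<bar> * (cmod (a (n, s * n)))^2)
          + (\<Sum>\<^sub>\<infinity>n\<in>(UNIV::int set). (cmod (a (n, s * n)))^2)
            * ln (sqrt (\<Sum>\<^sub>\<infinity>n\<in>(UNIV::int set). (cmod (a (n, s * n)))^2)))"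
proof -
  have line: "\<And>m n. n \<noteq> s * m \<Longrightarrow> a (m, n) = 0" using assms(4) by blast
  obtain T where T: "T \<in> rot_algebra \<theta>" and Ta: "coord (T vac) = a"
    using assms(5) unfolding strictly_pos_def in_A_iff by blast
  have TR: "T \<in> right_module_ops \<theta>" using T rot_algebra_right_module_ops by blast
  have star: "tw_star \<theta> a = a" using assms(5) by (simp add: strictly_pos_def)
  have sym: "symmetric_op T" using symmetric_op_coord[OF TR] star by (simp add: Ta)
  define \<sigma> where "\<sigma> = approx_spectrum T"
  have pos: "0 < t" if "t \<in> \<sigma>" for t
  proof -
    have "complex_of_real t \<in> spec \<theta> a"
      using spec_iff_approx_spectrum[OF T sym] that by (simp add: Ta \<sigma>_def)
    then have "\<exists>u::real. u > 0 \<and> complex_of_real t = complex_of_real u"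
      using assms(5) unfolding strictly_pos_def by blast
    then show ?thesis by auto
  qed
  have cont: "continuous_on \<sigma> ln" using pos by (intro continuous_intros) force
  \<comment> \<open>\<open>Y\<close> is the operator of the logarithm of \<open>a\<close>.\<close>
  obtain Y where Y: "Y \<in> rot_algebra \<theta>"
    "\<And>p e. 0 \<le> e \<Longrightarrow> (\<And>t. t \<in> \<sigma> \<Longrightarrow> \<bar>ln t - poly p t\<bar> \<le> e) \<Longrightarrow> norm (Y - blinfun_poly p T) \<le> e"
    using continuous_functional_calculus[OF T sym cont[unfolded \<sigma>_def]] unfolding \<sigma>_def by blast
  have cfc: "cfc \<theta> ln a = coord (Y vac)"
    using cfc_eq[OF T sym Y(1) cont[unfolded \<sigma>_def]] Y(2) unfolding \<sigma>_def Ta by blast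

  define S where "S = (\<Sum>\<^sub>\<infinity>n. (cmod (a (n, s * n)))\<^sup>2)"
  define D where "D = (\<Sum>\<^sub>\<infinity>n. real_of_int \<bar>n\<bar> * (cmod (a (n, s * n)))\<^sup>2)"
  have D: "((\<lambda>n. real_of_int \<bar>n\<bar> * (cmod (a (n, s * n)))\<^sup>2) has_sum D) UNIV"
    unfolding D_def by (rule has_sum_infsum[OF smooth_line_summable[OF assms(3)]])
  have D0: "0 \<le> D" using has_sum_nonneg[OF D] by simp
  have SN: "S = (norm (T vac))\<^sup>2"
    unfolding S_def norm_ell2_sq Ta by (rule line_infsum[symmetric]) (simp add: line)
  \<comment> \<open>Zero is not in the spectrum, so \<open>T\<close> is bounded below,
    \<open>T vac\<close> is nonzero and \<open>S\<close> is positive.\<close>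
  have "0 \<notin> \<sigma>" using pos by auto
  then have "bounded_below T" by (simp add: \<sigma>_def approx_spectrum_def)
  then obtain \<delta> where \<delta>: "\<delta> > 0" "\<delta> * norm vac \<le> norm (T vac)" unfolding bounded_below_def by blast
  have "0 < \<delta> * norm vac" using \<delta>(1) by simp
  then have "0 < norm (T vac)" using \<delta>(2) by (rule order_less_le_trans)
  then have S0: "0 < S" unfolding SN by (rule zero_less_power)
  \<comment> \<open>\<open>infsum\<close> is zero for a family that is not summable, so positivity
    of \<open>S\<close> already gives summability.\<close>
  have "(\<lambda>n. (cmod (a (n, s * n)))\<^sup>2) summable_on UNIV"
    using S0 infsum_not_exists unfolding S_def by fastforce
  then have S: "((\<lambda>n. (cmod (a (n, s * n)))\<^sup>2) has_sum S) UNIV"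
    unfolding S_def by (rule has_sum_infsum)

  \<comment> \<open>With this \<open>\<kappa>\<close> the fourth-power bound reads
    \<open>S\<^sup>2 * (1 + \<kappa> + \<kappa>\<^sup>2 / 2)\<close>. The numbers
    \<open>\<alpha>\<close> and \<open>\<beta>\<close> come from the tangent of the logarithm at
    \<open>t\<^sup>2 = S * exp \<kappa>\<close>, \<open>Q\<close> is the trace of the fourth power,
    and \<open>R\<close> is the bound aimed at, with constant two at \<open>D\<close>.\<close>
  define \<kappa> where "\<kappa> = 4 * D / S"
  define \<alpha> where "\<alpha> = (ln S + \<kappa> - 1) / 2"
  define \<beta> where "\<beta> = 1 / (2 * S * exp \<kappa>)"
  define Q where "Q = (norm (T (T vac)))\<^sup>2"
  define R where "R = S * ln S / 2 + 2 * D"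
  have aa: "tw_mult \<theta> a a = coord ((T o\<^sub>L T) vac)"
    using tw_mult_right_module_ops[OF TR, of "T vac"] by (simp add: Ta)
  have "Q \<le> S\<^sup>2 + 4 * D * S + 8 * D\<^sup>2"
    unfolding Q_def
    by (rule line_square_norm_bound[where a = a and s = s and \<theta> = \<theta>])
      (use line star S D aa in simp_all)
  also have "\<dots> = S\<^sup>2 * (1 + \<kappa> + \<kappa>\<^sup>2 / 2)"
    using S0 by (simp add: \<kappa>_def field_simps power2_eq_square)
  also have "\<dots> \<le> S\<^sup>2 * exp \<kappa>"
    using D0 S0 by (intro mult_left_mono exp_lower_Taylor_quadratic) (auto simp: \<kappa>_def)
  finally have "\<beta> * Q \<le> \<beta> * (S\<^sup>2 * exp \<kappa>)" using S0 by (intro mult_left_mono) (auto simp: \<beta>_def)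
  also have "\<dots> = S / 2" using S0 by (simp add: \<beta>_def field_simps power2_eq_square)
  also have "S / 2 = R - \<alpha> * S" using S0 by (simp add: R_def \<alpha>_def \<kappa>_def field_simps)
  finally have R: "\<alpha> * S + \<beta> * Q \<le> R" by simp
  have ln_le: "ln t \<le> \<alpha> + \<beta> * t\<^sup>2" if "0 < t" for t
  proof -
    have "ln (t\<^sup>2 / (S * exp \<kappa>)) \<le> t\<^sup>2 / (S * exp \<kappa>) - 1"
      using that S0 by (intro ln_le_minus_one) simp
    moreover have "ln (t\<^sup>2 / (S * exp \<kappa>)) = 2 * ln t - ln S - \<kappa>"
      using that S0 by (simp add: ln_div ln_mult ln_realpow)
    ultimately show ?thesis by (simp add: \<alpha>_def \<beta>_def field_simps)
  qed

  define w where "w = coord (T (T (Y vac))) 0"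
  \<comment> \<open>\<open>w\<close> is the trace in question. Replacing \<open>Y\<close> by
    \<open>p(T)\<close> costs \<open>e\<close> times the square of \<open>norm T\<close>; replacing
    the logarithm by \<open>p\<close> in the pointwise bound costs \<open>e * S\<close>.\<close>
  have main: "Re w \<le> R + e * (S + norm T * norm T)" "\<bar>Im w\<bar> \<le> e * (S + norm T * norm T)" if e: "0 < e" for e
  proof -
    obtain p where p: "\<And>t. t \<in> \<sigma> \<Longrightarrow> \<bar>ln t - poly p t\<bar> \<le> e"
      using real_poly_approximation[OF compact_approx_spectrum cont[unfolded \<sigma>_def] e] unfolding \<sigma>_def by blast
    let ?P = "blinfun_poly p T" and ?G = "blinfun_poly ([:0, 1:] * (p * [:0, 1:])) T"
    have X: "blinfun_poly [:0, 1:] T = T" by (simp add: blinfun_compose_simps)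
    \<comment> \<open>Two factorisations of the same operator: this one yields the form of
      \<open>p(T)\<close> at \<open>T vac\<close>, the next one is compared with
      \<open>w\<close>.\<close>
    have G: "?G = T o\<^sub>L (?P o\<^sub>L T)" by (simp only: blinfun_poly_mult X)
    have G': "?G = T o\<^sub>L (T o\<^sub>L ?P)" by (simp only: mult.commute[of p] blinfun_poly_mult X)
    have GR: "?G \<in> right_module_ops \<theta>"
      using rot_algebra_poly[OF T] rot_algebra_right_module_ops by blast
    have "w - coord (?G vac) 0 = coord (T (T ((Y - ?P) vac))) 0"
      by (simp add: w_def G' blinfun.bilinear_simps)
    then have "cmod (w - coord (?G vac) 0) \<le> norm (T (T ((Y - ?P) vac)))"
      using cmod_coord_le by metis
    also have "\<dots> \<le> norm T * (norm T * (norm (Y - ?P) * norm vac))"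
      using norm_blinfun by (meson mult_left_mono norm_ge_zero order_trans)
    also have "\<dots> \<le> norm T * (norm T * e)"
      using Y(2)[OF less_imp_le[OF e] p] by (intro mult_left_mono) auto
    finally have diff: "cmod (w - coord (?G vac) 0) \<le> e * (norm T * norm T)" by (simp add: mult_ac)
    \<comment> \<open>The pointwise bound as an operator inequality at \<open>T vac\<close>, where
      constants contribute multiples of \<open>S\<close> and the square contributes
      \<open>Q\<close>.\<close>
    have "0 \<le> blinfun_poly ([:\<alpha> + e, 0, \<beta>:] - p) T (T vac) \<bullet> T vac"
    proof (rule blinfun_poly_nonneg[OF sym])
      fix t assume "t \<in> approx_spectrum T"
      then have t: "t \<in> \<sigma>" by (simp add: \<sigma>_def)
      show "0 \<le> poly ([:\<alpha> + e, 0, \<beta>:] - p) t"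
        using p[OF t] ln_le[OF pos[OF t]] by (simp add: power2_eq_square algebra_simps)
    qed
    also have "\<dots> = (\<alpha> + e) * S + \<beta> * Q - vac \<bullet> ?G vac"
      using symmetric_opD[OF sym, of vac "?P (T vac)"] symmetric_opD[OF sym, of "T (T vac)" "T vac"]
      unfolding G
      by (simp add: blinfun.bilinear_simps inner_simps SN Q_def power2_norm_eq_inner inner_commute algebra_simps)
    finally have "Re (coord (?G vac) 0) \<le> R + e * S"
      using R by (simp add: inner_basis inner_complex_def algebra_simps)
    moreover have "Re w - Re (coord (?G vac) 0) \<le> e * (norm T * norm T)"
      using diff complex_Re_le_cmod[of "w - coord (?G vac) 0"] by simp
    ultimately show "Re w \<le> R + e * (S + norm T * norm T)" by (simp add: algebra_simps)
    have "Im (coord (?G vac) 0) = 0" by (rule coord_symmetric_real[OF GR symmetric_op_poly[OF sym]])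
    then have "\<bar>Im w\<bar> \<le> e * (norm T * norm T)"
      using diff abs_Im_le_cmod[of "w - coord (?G vac) 0"] by simp
    also have "\<dots> \<le> e * (S + norm T * norm T)" using e S0 by (intro mult_left_mono) auto
    finally show "\<bar>Im w\<bar> \<le> e * (S + norm T * norm T)" .
  qed
  define C where "C = S + norm T * norm T"
  have C: "0 < C" using S0 by (simp add: C_def add_pos_nonneg)
  have eps: "Re w \<le> R + e" "\<bar>Im w\<bar> \<le> 0 + e" if "0 < e" for e
    using main[of "e / C"] that C unfolding C_def[symmetric] by simp_all
  have w: "Re w \<le> R" "\<bar>Im w\<bar> \<le> 0"
    by (rule field_le_epsilon, erule eps)+
  \<comment> \<open>A nonzero integer has modulus at least one, so \<open>1 + \<bar>s\<bar>\<close>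
    is at least the constant two in \<open>R\<close>.\<close>
  have s1: "1 \<le> real_of_int \<bar>s\<bar>" using assms(2) by linarith
  have "tau (tw_mult \<theta> (tw_mult \<theta> a a) (cfc \<theta> ln a)) = w"
    unfolding aa cfc tau_def w_def
    using tw_mult_right_module_ops[OF right_module_ops_linear(4)[OF TR TR]] by (simp add: zero_prod_def)
  moreover have "R \<le> (\<Sum>\<^sub>\<infinity>n. (1 + real_of_int \<bar>s\<bar>) * real_of_int \<bar>n\<bar> * (cmod (a (n, s * n)))\<^sup>2) + S * ln (sqrt S)"
  proof -
    have "(\<Sum>\<^sub>\<infinity>n. (1 + real_of_int \<bar>s\<bar>) * real_of_int \<bar>n\<bar> * (cmod (a (n, s * n)))\<^sup>2) = (1 + real_of_int \<bar>s\<bar>) * D"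
      unfolding D_def mult.assoc by (rule infsum_cmult_right')
    moreover have "2 * D \<le> (1 + real_of_int \<bar>s\<bar>) * D" using s1 D0 by (intro mult_right_mono) auto
    ultimately show ?thesis using S0 by (simp add: R_def ln_sqrt)
  qed
  \<comment> \<open>The order on complex numbers demands equal imaginary parts, hence the bound on
    \<open>Im w\<close>.\<close>
  ultimately show ?thesis
    using w unfolding S_def[symmetric] by (simp add: less_eq_complex_def)
qed

end
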